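(* In the independent action model of the sequential contract problem, an optimal linear contract, i.e. a value $\alpha\in[0,1]$ maximizing $u_P(t_\alpha)$ over all $\alpha\in[0,1]$, can be computed in time polynomial in the number of actions $n$ and the number of outcomes $m$.
   Context: Sequential contract problem. An instance consists of a set $A$ of $n$ actions with costs $c_i\ge 0$ ($i\in A$), a set $[m]=\{1,\dots,m\}$ of outcomes with principal rewards $0=r(1)\le r(2)\le\dots\le r(m)$, and random variables $X_i$ with values in $[m]$ ($i\in A$), where $X_i$ is the outcome of action $i$. In the independent action model the $X_i$ are independent and $p_{ij}=\Pr[X_i=j]$; the input is the costs, the rewards and the probabilities $p_{ij}$. A contract is a function $t:[m]\to\mathbb{R}_{\ge 0}$. Given $t$, the agent acts sequentially: at each point he either takes a not-yet-taken action $i$, pays $c_i$ and observes the realization of $X_i$, or halts. On halting he selects one revealed outcome as the final outcome; outcome $1$ (the zero outcome) is always considered revealed. A (deterministic) strategy $\pi$ specifies all these decisions as a function of the history; there are finitely many strategies. $S(\pi)$ is the random set of actions taken, $\omega(\pi)$ the random final outcome. Utilities: $u_A(t,\pi)=\mathbb{E}[t(\omega(\pi))-\sum_{i\in S(\pi)}c_i]$ and $u_P(t,\pi)=\mathbb{E}[r(\omega(\pi))-t(\omega(\pi))]$. The best response $\pi^\star(t)$ is a strategy maximizing $u_A(t,\cdot)$, with ties broken in favour of larger $u_P(t,\cdot)$ and remaining ties broken consistently by a fixed total order on strategies. $u_P(t)=u_P(t,\pi^\star(t))$. A linear contract with parameter $\alpha\in[0,1]$ is $t_\alpha(j)=\alpha\cdot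 r(j)$. *)

theory Defs
  imports "HOL-Probability.Probability"
begin

section \<open>Sequential contracts\<close>

text \<open>
  The actions are \<open>1, \<dots>, n\<close> and the outcomes \<open>1, \<dots>, m\<close>.  The random variables \<open>X\<^sub>i\<close> are
  given by their joint law: \<open>joint I\<close> is a distribution on profiles \<open>x\<close>, where \<open>x i\<close> is the
  realization of \<open>X\<^sub>i\<close> (coordinates that are not actions play no role).
\<close>

record seq_contract =
  num_actions :: nat
  num_outcomes :: nat
  cost :: "nat \<Rightarrow> real"
  reward :: "nat \<Rightarrow> real"
  joint :: "(nat \<Rightarrow> nat) pmf"

definition actions :: "seq_contract \<Rightarrow> nat set" where
  "actions I = {1..num_actions I}"

definition outcomes :: "seq_contract \<Rightarrow> nat set" where
  "outcomes I = {1..num_outcomes I}"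

definition valid_instance :: "seq_contract \<Rightarrow> bool" where
  "valid_instance I \<longleftrightarrow>
     num_outcomes I \<ge> 1 \<and>
     (\<forall>i\<in>actions I. cost I i \<ge> 0) \<and>
     reward I 1 = 0 \<and> mono_on (outcomes I) (reward I) \<and>
     (\<forall>x\<in>set_pmf (joint I). \<forall>i\<in>actions I. x i \<in> outcomes I)"

definition independent_actions :: "seq_contract \<Rightarrow> bool" where
  "independent_actions I \<longleftrightarrow>
     prob_space.indep_vars (measure_pmf (joint I)) (\<lambda>_. count_space UNIV) (\<lambda>i x. x i) (actions I)"

definition outcome_prob :: "seq_contract \<Rightarrow> nat \<Rightarrow> nat \<Rightarrow> real" where
  "outcome_prob I i j = measure_pmf.prob (joint I) {x. x i = j}"

subsection \<open>Strategies\<close>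

text \<open>
  A history lists the actions taken so far with the outcomes observed, most recent first.
  A strategy is an extensional function on all histories (also those it never reaches itself),
  so that there are only finitely many strategies.
\<close>

type_synonym history = "(nat \<times> nat) list"

datatype decision = Take nat | Halt nat

type_synonym strategy = "history \<Rightarrow> decision"

definition histories :: "seq_contract \<Rightarrow> history set" where
  "histories I = {h. distinct (map fst h) \<and> set h \<subseteq> actions I \<times> outcomes I}"

definition decisions :: "seq_contract \<Rightarrow> history \<Rightarrow> decision set" where
  "decisions I h = Take ` (actions I - fst ` set h) \<union> Halt ` insert 1 (snd ` set h)"

definition strategies :: "seq_contract \<Rightarrow> strategy set" where
  "strategies I = (\<Pi>\<^sub>E h\<in>histories I. decisions I h)"

fun history_after :: "strategy \<Rightarrow> (nat \<Rightarrow> nat) \<Rightarrow> nat \<Rightarrow> history" where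
  "history_after \<pi> x 0 = []"
| "history_after \<pi> x (Suc k) =
     (let h = history_after \<pi> x k in
      case \<pi> h of Take i \<Rightarrow> (i, x i) # h | Halt j \<Rightarrow> h)"

text \<open>No action is taken twice, so every strategy has halted after \<open>n\<close> steps.\<close>

definition final_history :: "seq_contract \<Rightarrow> strategy \<Rightarrow> (nat \<Rightarrow> nat) \<Rightarrow> history" where
  "final_history I \<pi> x = history_after \<pi> x (num_actions I)"

definition taken :: "seq_contract \<Rightarrow> strategy \<Rightarrow> (nat \<Rightarrow> nat) \<Rightarrow> nat set" where
  "taken I \<pi> x = fst ` set (final_history I \<pi> x)"

definition final_outcome :: "seq_contract \<Rightarrow> strategy \<Rightarrow> (nat \<Rightarrow> nat) \<Rightarrow> nat" where
  "final_outcome I \<pi> x = (case \<pi> (final_history I \<pi> x) of Halt j \<Rightarrow> j)"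

subsection \<open>Utilities and best responses\<close>

definition agent_utility :: "seq_contract \<Rightarrow> (nat \<Rightarrow> real) \<Rightarrow> strategy \<Rightarrow> real" where
  "agent_utility I t \<pi> = measure_pmf.expectation (joint I)
     (\<lambda>x. t (final_outcome I \<pi> x) - (\<Sum>i\<in>taken I \<pi> x. cost I i))"

definition principal_utility :: "seq_contract \<Rightarrow> (nat \<Rightarrow> real) \<Rightarrow> strategy \<Rightarrow> real" where
  "principal_utility I t \<pi> = measure_pmf.expectation (joint I)
     (\<lambda>x. reward I (final_outcome I \<pi> x) - t (final_outcome I \<pi> x))"

definition agent_optimal :: "seq_contract \<Rightarrow> (nat \<Rightarrow> real) \<Rightarrow> strategy set" where
  "agent_optimal I t = {\<pi>. is_arg_max (agent_utility I t) (\<lambda>\<pi>. \<pi> \<in> strategies I) \<pi>}"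

definition tie_optimal :: "seq_contract \<Rightarrow> (nat \<Rightarrow> real) \<Rightarrow> strategy set" where
  "tie_optimal I t = {\<pi>. is_arg_max (principal_utility I t) (\<lambda>\<pi>. \<pi> \<in> agent_optimal I t) \<pi>}"

text \<open>\<open>ord\<close> is the fixed total order on strategies; its least element among the candidates is chosen.\<close>

definition best_response :: "seq_contract \<Rightarrow> strategy rel \<Rightarrow> (nat \<Rightarrow> real) \<Rightarrow> strategy" where
  "best_response I ord t =
     (THE \<pi>. \<pi> \<in> tie_optimal I t \<and> (\<forall>\<pi>'\<in>tie_optimal I t. (\<pi>, \<pi>') \<in> ord))"

definition principal_value :: "seq_contract \<Rightarrow> strategy rel \<Rightarrow> (nat \<Rightarrow> real) \<Rightarrow> real" where
  "principal_value I ord t = principal_utility I t (best_response I ord t)"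

definition linear_contract :: "seq_contract \<Rightarrow> real \<Rightarrow> nat \<Rightarrow> real" where
  "linear_contract I \<alpha> j = \<alpha> * reward I j"

definition optimal_linear :: "seq_contract \<Rightarrow> strategy rel \<Rightarrow> real \<Rightarrow> bool" where
  "optimal_linear I ord \<alpha> \<longleftrightarrow>
     is_arg_max (\<lambda>\<beta>. principal_value I ord (linear_contract I \<beta>)) (\<lambda>\<beta>. \<beta> \<in> {0..1}) \<alpha>"

subsection \<open>Well-definedness\<close>

lemma finite_histories: "finite (histories I)"
proof -
  let ?S = "actions I \<times> outcomes I"
  have fin: "finite ?S" by (simp add: actions_def outcomes_def)
  have "length h \<le> card ?S" if "h \<in> histories I" for h
  proof -
    have "distinct h" "set h \<subseteq> ?S" using that by (auto simp: histories_def distinct_map)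
    then show ?thesis using card_mono[OF fin] distinct_card by metis
  qed
  then have "histories I \<subseteq> {h. set h \<subseteq> ?S \<and> length h \<le> card ?S}"
    by (auto simp: histories_def)
  then show ?thesis
    using finite_lists_length_le[OF fin] finite_subset by blast
qed

lemma finite_strategies: "finite (strategies I)"
  unfolding strategies_def
  by (intro finite_PiE finite_histories) (auto simp: decisions_def actions_def)

lemma strategies_nonempty: "strategies I \<noteq> {}"
  by (auto simp: strategies_def PiE_eq_empty_iff decisions_def)

lemma is_arg_max_nonempty:
  fixes f :: "'a \<Rightarrow> real"
  assumes "finite S" "S \<noteq> {}"
  shows "{x. is_arg_max f (\<lambda>x. x \<in> S) x} \<noteq> {}"
proof -
  obtain x where "x \<in> S" "f x = Max (f ` S)"
    using Max_in[of "f ` S"] assms by fastforce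
  then have "is_arg_max f (\<lambda>x. x \<in> S) x"
    using assms by (auto simp: is_arg_max_def not_less)
  then show ?thesis by blast
qed

lemma linear_order_on_least:
  assumes ord: "linear_order_on S ord" and "finite T" "T \<noteq> {}" "T \<subseteq> S"
  shows "\<exists>!x. x \<in> T \<and> (\<forall>y\<in>T. (x, y) \<in> ord)"
proof -
  have props: "refl_on S ord" "trans ord" "antisym ord" "total_on S ord"
    using ord by (auto simp: order_on_defs)
  have "\<exists>x\<in>T. \<forall>y\<in>T. (x, y) \<in> ord"
    using \<open>finite T\<close> \<open>T \<noteq> {}\<close> \<open>T \<subseteq> S\<close>
  proof (induction rule: finite_ne_induct)
    case (singleton a)
    then show ?case using props by (auto simp: refl_on_def)
  next
    case (insert a F)
    then obtain x where x: "x \<in> F" "\<forall>y\<in>F. (x, y) \<in> ord" by auto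
    have "(a, x) \<in> ord \<or> (x, a) \<in> ord"
      using props(1,4) insert.prems x(1) by (metis insertCI refl_on_def subsetD total_on_def)
    moreover have "(a, a) \<in> ord" using props insert.prems by (simp add: refl_on_def)
    moreover have "(a, x) \<in> ord \<Longrightarrow> \<forall>y\<in>F. (a, y) \<in> ord"
      using x(2) transD[OF props(2)] by metis
    ultimately show ?case using x by (metis insertE insertCI)
  qed
  then show ?thesis using antisymD[OF props(3)] by metis
qed

lemma best_response_tie_optimal:
  assumes "linear_order_on (strategies I) ord"
  shows "best_response I ord t \<in> tie_optimal I t"
proof -
  let ?A = "agent_optimal I t" and ?T = "tie_optimal I t"
  have A: "?A \<subseteq> strategies I" and T: "?T \<subseteq> ?A"
    by (auto simp: agent_optimal_def tie_optimal_def is_arg_max_def)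
  have "?A \<noteq> {}"
    unfolding agent_optimal_def by (rule is_arg_max_nonempty[OF finite_strategies strategies_nonempty])
  then have "?T \<noteq> {}"
    unfolding tie_optimal_def by (rule is_arg_max_nonempty[OF finite_subset[OF A finite_strategies]])
  moreover have "?T \<subseteq> strategies I" using A T by (rule subset_trans[rotated])
  ultimately have "\<exists>!\<pi>. \<pi> \<in> ?T \<and> (\<forall>\<pi>'\<in>?T. (\<pi>, \<pi>') \<in> ord)"
    using linear_order_on_least[OF assms finite_subset[OF _ finite_strategies]] by blast
  from theI'[OF this] show ?thesis unfolding best_response_def by (rule conjunct1)
qed


section \<open>A real random access machine\<close>

text \<open>
  Running time polynomial in \<open>n\<close> and \<open>m\<close> alone is time in the unit-cost arithmetic model:
  programs act on exact real numbers by \<open>+, -, *, /\<close> and comparisons.  There is no rounding.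
  The natural number variables are for counting and for indexing the arrays of reals; as they can
  only be added, subtracted and compared, unit cost is harmless for them, too.  Literals are
  integers.  Each name denotes one natural number variable and one unbounded two-dimensional array
  of reals.
\<close>

type_synonym vname = string

record state =
  nats :: "vname \<Rightarrow> nat"
  reals :: "vname \<Rightarrow> nat \<Rightarrow> nat \<Rightarrow> real"

datatype nexp =
    NLit nat
  | NVar vname
  | NAdd nexp nexp
  | NSub nexp nexp

datatype rexp =
    RLit int
  | RCell vname nexp nexp
  | RAdd rexp rexp
  | RSub rexp rexp
  | RMul rexp rexp
  | RDiv rexp rexp

datatype bexp =
    NLess nexp nexp
  | RLess rexp rexp
  | BNot bexp
  | BAnd bexp bexp

datatype com =
    SKIP
  | NAssign vname nexp
  | RAssign vname nexp nexp rexp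
  | Seq com com
  | IF bexp com com
  | WHILE bexp com

text \<open>Subtraction of natural numbers is truncated, and division by 0 gives 0.\<close>

fun nval :: "nexp \<Rightarrow> state \<Rightarrow> nat" where
  "nval (NLit k) s = k"
| "nval (NVar v) s = nats s v"
| "nval (NAdd a b) s = nval a s + nval b s"
| "nval (NSub a b) s = nval a s - nval b s"

fun rval :: "rexp \<Rightarrow> state \<Rightarrow> real" where
  "rval (RLit k) s = real_of_int k"
| "rval (RCell v a b) s = reals s v (nval a s) (nval b s)"
| "rval (RAdd a b) s = rval a s + rval b s"
| "rval (RSub a b) s = rval a s - rval b s"
| "rval (RMul a b) s = rval a s * rval b s"
| "rval (RDiv a b) s = rval a s / rval b s"

fun bval :: "bexp \<Rightarrow> state \<Rightarrow> bool" where
  "bval (NLess a b) s \<longleftrightarrow> nval a s < nval b s"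
| "bval (RLess a b) s \<longleftrightarrow> rval a s < rval b s"
| "bval (BNot b) s \<longleftrightarrow> \<not> bval b s"
| "bval (BAnd a b) s \<longleftrightarrow> bval a s \<and> bval b s"

definition set_nat :: "vname \<Rightarrow> nat \<Rightarrow> state \<Rightarrow> state" where
  "set_nat v k s = s\<lparr>nats := (nats s)(v := k)\<rparr>"

definition set_real :: "vname \<Rightarrow> nat \<Rightarrow> nat \<Rightarrow> real \<Rightarrow> state \<Rightarrow> state" where
  "set_real v i j a s =
     s\<lparr>reals := (reals s)(v := (reals s v)(i := (reals s v i)(j := a)))\<rparr>"

text \<open>
  \<open>exec c s k s'\<close>: started in \<open>s\<close>, program \<open>c\<close> halts in \<open>s'\<close> after \<open>k\<close> steps.  Every assignment
  and every evaluation of a branching condition is one step.  The expressions are part of the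
  program, whose size does not depend on the input, so counting the operations inside them
  would change the running time by a constant factor only.
\<close>

inductive exec :: "com \<Rightarrow> state \<Rightarrow> nat \<Rightarrow> state \<Rightarrow> bool" where
  Skip: "exec SKIP s 1 s"
| NAssign: "exec (NAssign v a) s 1 (set_nat v (nval a s) s)"
| RAssign: "exec (RAssign v a b e) s 1 (set_real v (nval a s) (nval b s) (rval e s) s)"
| Seq: "exec c1 s k1 s' \<Longrightarrow> exec c2 s' k2 s'' \<Longrightarrow> exec (Seq c1 c2) s (k1 + k2) s''"
| IfTrue: "bval b s \<Longrightarrow> exec c1 s k s' \<Longrightarrow> exec (IF b c1 c2) s (Suc k) s'"
| IfFalse: "\<not> bval b s \<Longrightarrow> exec c2 s k s' \<Longrightarrow> exec (IF b c1 c2) s (Suc k) s'"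
| WhileFalse: "\<not> bval b s \<Longrightarrow> exec (WHILE b c) s 1 s"
| WhileTrue: "bval b s \<Longrightarrow> exec c s k1 s' \<Longrightarrow> exec (WHILE b c) s' k2 s'' \<Longrightarrow>
    exec (WHILE b c) s (Suc (k1 + k2)) s''"

inductive_cases exec_cases:
  "exec SKIP s k s'"
  "exec (NAssign v a) s k s'"
  "exec (RAssign v a b e) s k s'"
  "exec (Seq c1 c2) s k s'"
  "exec (IF b c1 c2) s k s'"
  "exec (WHILE b c) s k s'"

lemma exec_deterministic: "exec c s k s' \<Longrightarrow> exec c s k' s'' \<Longrightarrow> k' = k \<and> s'' = s'"
proof (induction arbitrary: k' s'' rule: exec.induct)
  case Skip
  then show ?case by (auto elim: exec_cases(1))
next
  case NAssign
  then show ?case by (auto elim: exec_cases(2))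
next
  case RAssign
  then show ?case by (auto elim: exec_cases(3))
next
  case Seq
  from Seq.prems show ?case by (rule exec_cases(4)) (metis Seq.IH)
next
  case IfTrue
  from IfTrue.prems show ?case by (rule exec_cases(5)) (metis IfTrue.IH IfTrue.hyps)+
next
  case IfFalse
  from IfFalse.prems show ?case by (rule exec_cases(5)) (metis IfFalse.IH IfFalse.hyps)+
next
  case WhileFalse
  from WhileFalse.prems show ?case by (rule exec_cases(6)) (use WhileFalse.hyps in auto)
next
  case WhileTrue
  from WhileTrue.prems show ?case
    by (rule exec_cases(6)) (metis WhileTrue.IH WhileTrue.hyps)+
qed

subsection \<open>Input and output\<close>

text \<open>The machine sees the numbers \<open>n\<close>, \<open>m\<close>, \<open>c\<^sub>i\<close>, \<open>r(j)\<close>, \<open>p\<^sub>i\<^sub>j\<close> and nothing else; all other memory is 0.\<close>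

definition input_state :: "seq_contract \<Rightarrow> state" where
  "input_state I =
    \<lparr>nats = (\<lambda>_. 0)(''n'' := num_actions I, ''m'' := num_outcomes I),
     reals = (\<lambda>_ _ _. 0)
       (''c'' := \<lambda>i k. if i \<in> actions I \<and> k = 0 then cost I i else 0,
        ''r'' := \<lambda>j k. if j \<in> outcomes I \<and> k = 0 then reward I j else 0,
        ''p'' := \<lambda>i j. if i \<in> actions I \<and> j \<in> outcomes I then outcome_prob I i j else 0)\<rparr>"

definition machine_output :: "state \<Rightarrow> real" where
  "machine_output s = reals s ''alpha'' 0 0"

end

theory Submission
  imports Defs
begin

text \<open>
  For a strategy \<open>\<pi>\<close> with expected reward \<open>R(\<pi>)\<close> and expected cost \<open>C(\<pi>)\<close>, the agent's optimal utility
  \<open>U(\<alpha>) = max\<^sub>\<pi> \<alpha> R(\<pi>) - C(\<pi>)\<close> is convex and piecewise linear in \<open>\<alpha>\<close>; by the tie-breaking rule the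
  principal obtains \<open>1 - \<alpha>\<close> times the right derivative of \<open>U\<close> at \<open>\<alpha>\<close>, so some optimal \<open>\<alpha>\<close> is 0 or a
  breakpoint of \<open>U\<close>.

  The agent faces Weitzman's Pandora's box problem, whence \<open>U(\<alpha>) = E[max\<^sub>i min(\<alpha> r(X\<^sub>i), \<sigma>\<^sub>i(\<alpha>))\<^sup>+]\<close>, where
  the reservation value \<open>\<sigma>\<^sub>i(\<alpha>)\<close> solves \<open>E[(\<alpha> r(X\<^sub>i) - \<sigma>)\<^sup>+] = c\<^sub>i\<close>.  Since \<open>r\<close> is monotone, \<open>\<sigma>\<^sub>i(\<alpha>)\<close> is the
  maximum over \<open>l\<close> of the affine functions \<open>(\<alpha> A\<^sub>i\<^sub>l - c\<^sub>i) / P\<^sub>i\<^sub>l\<close>, with \<open>P\<^sub>i\<^sub>l\<close> the probability of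
  \<open>X\<^sub>i \<ge> l\<close> and \<open>A\<^sub>i\<^sub>l\<close> the expectation of \<open>r(X\<^sub>i)\<close> on that event.  Hence \<open>U\<close> is affine wherever these
  lines and the lines \<open>\<alpha> r(j)\<close> do not cross, and the \<open>O(n\<^sup>2m\<^sup>2)\<close> crossing points contain all breakpoints.

  At such a point the right derivative of the convex function \<open>U\<close> is the least slope of a chord to
  a later crossing point or to 1, so the optimum is a closed formula built from arithmetic,
  comparisons, and sums, products, maxima and minima of ranges \<open>1..n\<close> and \<open>1..m\<close>.  Every formula of
  this kind compiles to a program of polynomial running time.
\<close>


section \<open>Compiling arithmetic formulas\<close>

datatype aop = AAdd | ASub | AMul | ADiv | AMax | AMin

fun aop_val :: "aop \<Rightarrow> real \<Rightarrow> real \<Rightarrow> real" where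
  "aop_val AAdd x y = x + y"
| "aop_val ASub x y = x - y"
| "aop_val AMul x y = x * y"
| "aop_val ADiv x y = x / y"
| "aop_val AMax x y = max x y"
| "aop_val AMin x y = min x y"

text \<open>The only iteration is a reduction over 1..n or 1..m, so the running time of every
  formula is polynomial by structure alone.\<close>

datatype fx =
    XLit int
  | XVar nat
  | XCost nat
  | XRew nat
  | XProb nat nat
  | XBin aop fx fx
  | XLess fx fx fx fx
  | XNLess nat nat fx fx
  | XLet nat fx fx
  | XRed aop bool nat fx fx

definition bound_name :: "bool \<Rightarrow> vname" where
  "bound_name b = (if b then ''n'' else ''m'')"

primrec fval :: "state \<Rightarrow> fx \<Rightarrow> (nat \<Rightarrow> nat) \<Rightarrow> (nat \<Rightarrow> real) \<Rightarrow> real" where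
  "fval s (XLit k) \<rho> \<theta> = real_of_int k"
| "fval s (XVar x) \<rho> \<theta> = \<theta> x"
| "fval s (XCost i) \<rho> \<theta> = reals s ''c'' (\<rho> i) 0"
| "fval s (XRew j) \<rho> \<theta> = reals s ''r'' (\<rho> j) 0"
| "fval s (XProb i j) \<rho> \<theta> = reals s ''p'' (\<rho> i) (\<rho> j)"
| "fval s (XBin f a b) \<rho> \<theta> = aop_val f (fval s a \<rho> \<theta>) (fval s b \<rho> \<theta>)"
| "fval s (XLess a b e f) \<rho> \<theta> =
     (if fval s a \<rho> \<theta> < fval s b \<rho> \<theta> then fval s e \<rho> \<theta> else fval s f \<rho> \<theta>)"
| "fval s (XNLess i j e f) \<rho> \<theta> = (if \<rho> i < \<rho> j then fval s e \<rho> \<theta> else fval s f \<rho> \<theta>)"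
| "fval s (XLet x a b) \<rho> \<theta> = fval s b \<rho> (\<theta>(x := fval s a \<rho> \<theta>))"
| "fval s (XRed f b v a e) \<rho> \<theta> =
     fold (\<lambda>i y. aop_val f y (fval s e (\<rho>(v := i)) \<theta>)) [1..<Suc (nats s (bound_name b))] (fval s a \<rho> \<theta>)"

text \<open>Words over the single letter i supply infinitely many counter names that never clash
  with the inputs \<open>n\<close> and \<open>m\<close>.\<close>

definition slot :: "nat \<Rightarrow> vname" where
  "slot d = replicate d (CHR ''i'')"

abbreviation tmp :: "nat \<Rightarrow> rexp" where
  "tmp d \<equiv> RCell ''t'' (NLit d) (NLit 0)"

abbreviation set_tmp :: "nat \<Rightarrow> rexp \<Rightarrow> com" where
  "set_tmp d e \<equiv> RAssign ''t'' (NLit d) (NLit 0) e"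

fun apply_op :: "aop \<Rightarrow> nat \<Rightarrow> com" where
  "apply_op AAdd d = set_tmp d (RAdd (tmp d) (tmp (Suc d)))"
| "apply_op ASub d = set_tmp d (RSub (tmp d) (tmp (Suc d)))"
| "apply_op AMul d = set_tmp d (RMul (tmp d) (tmp (Suc d)))"
| "apply_op ADiv d = set_tmp d (RDiv (tmp d) (tmp (Suc d)))"
| "apply_op AMax d = IF (RLess (tmp d) (tmp (Suc d))) (set_tmp d (tmp (Suc d))) SKIP"
| "apply_op AMin d = IF (RLess (tmp (Suc d)) (tmp d)) (set_tmp d (tmp (Suc d))) SKIP"

text \<open>
  The value of the expression ends up in slot \<open>d\<close>; the slots below \<open>d\<close> hold the live variables, at
  the places given by \<open>\<eta>\<close> and \<open>\<zeta>\<close>.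
\<close>

primrec compile :: "fx \<Rightarrow> nat \<Rightarrow> (nat \<Rightarrow> nat) \<Rightarrow> (nat \<Rightarrow> nat) \<Rightarrow> com" where
  "compile (XLit k) d \<eta> \<zeta> = set_tmp d (RLit k)"
| "compile (XVar x) d \<eta> \<zeta> = set_tmp d (tmp (\<zeta> x))"
| "compile (XCost i) d \<eta> \<zeta> = set_tmp d (RCell ''c'' (NVar (slot (\<eta> i))) (NLit 0))"
| "compile (XRew i) d \<eta> \<zeta> = set_tmp d (RCell ''r'' (NVar (slot (\<eta> i))) (NLit 0))"
| "compile (XProb i j) d \<eta> \<zeta> = set_tmp d (RCell ''p'' (NVar (slot (\<eta> i))) (NVar (slot (\<eta> j))))"
| "compile (XBin f a b) d \<eta> \<zeta> =
     Seq (compile a d \<eta> \<zeta>) (Seq (compile b (Suc d) \<eta> \<zeta>) (apply_op f d))"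
| "compile (XLess a b e f) d \<eta> \<zeta> =
     Seq (compile a d \<eta> \<zeta>) (Seq (compile b (Suc d) \<eta> \<zeta>)
       (IF (RLess (tmp d) (tmp (Suc d))) (compile e d \<eta> \<zeta>) (compile f d \<eta> \<zeta>)))"
| "compile (XNLess i j e f) d \<eta> \<zeta> =
     IF (NLess (NVar (slot (\<eta> i))) (NVar (slot (\<eta> j)))) (compile e d \<eta> \<zeta>) (compile f d \<eta> \<zeta>)"
| "compile (XLet x a b) d \<eta> \<zeta> =
     Seq (compile a d \<eta> \<zeta>) (Seq (compile b (Suc d) \<eta> (\<zeta>(x := d))) (set_tmp d (tmp (Suc d))))"
| "compile (XRed f b v a e) d \<eta> \<zeta> =
     Seq (compile a d \<eta> \<zeta>) (Seq (NAssign (slot d) (NLit 1))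
       (WHILE (NLess (NVar (slot d)) (NAdd (NVar (bound_name b)) (NLit 1)))
         (Seq (compile e (Suc d) (\<eta>(v := d)) \<zeta>)
           (Seq (apply_op f d) (NAssign (slot d) (NAdd (NVar (slot d)) (NLit 1)))))))"

text \<open>\<open>B\<close> is to bound n and m, and both branches of a conditional are charged, so
  the bound does not depend on the state. A round of a reduction costs its body plus 4: one test, at
  most two steps for the operation, one increment. The 2 outside pays for setting the counter and
  for the last test.\<close>

primrec time :: "fx \<Rightarrow> nat \<Rightarrow> nat" where
  "time (XLit k) B = 1"
| "time (XVar x) B = 1"
| "time (XCost i) B = 1"
| "time (XRew j) B = 1"
| "time (XProb i j) B = 1"
| "time (XBin f a b) B = time a B + time b B + 2"
| "time (XLess a b e f) B = time a B + time b B + time e B + time f B + 1"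
| "time (XNLess i j e f) B = time e B + time f B + 1"
| "time (XLet x a b) B = time a B + time b B + 1"
| "time (XRed f b v a e) B = time a B + 2 + B * (time e B + 4)"

section \<open>Polynomial bounds on running times\<close>

lemma poly_bound_add:
  fixes f g :: "nat \<Rightarrow> nat"
  assumes "\<exists>C d. \<forall>B\<ge>1. f B \<le> C * B ^ d" "\<exists>C d. \<forall>B\<ge>1. g B \<le> C * B ^ d"
  shows "\<exists>C d. \<forall>B\<ge>1. f B + g B \<le> C * B ^ d"
proof -
  obtain C d C' d' where *: "\<forall>B\<ge>1. f B \<le> C * B ^ d" "\<forall>B\<ge>1. g B \<le> C' * B ^ d'"
    using assms by blast
  have "f B + g B \<le> (C + C') * B ^ (d + d')" if "B \<ge> 1" for B
  proof -
    have "B ^ d \<le> B ^ (d + d')" "B ^ d' \<le> B ^ (d + d')"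
      using that by (simp_all add: power_increasing)
    then have "C * B ^ d \<le> C * B ^ (d + d')" "C' * B ^ d' \<le> C' * B ^ (d + d')"
      by simp_all
    moreover have "f B \<le> C * B ^ d" "g B \<le> C' * B ^ d'" using * that by blast+
    ultimately show ?thesis unfolding distrib_right by linarith
  qed
  then show ?thesis by blast
qed

lemma poly_bound_const: "\<exists>C d. \<forall>B\<ge>1. (k::nat) \<le> C * B ^ d"
  by (rule exI[of _ k], rule exI[of _ 0]) simp

lemma poly_bound_times:
  fixes f :: "nat \<Rightarrow> nat"
  assumes "\<exists>C d. \<forall>B\<ge>1. f B \<le> C * B ^ d"
  shows "\<exists>C d. \<forall>B\<ge>1. B * f B \<le> C * B ^ d"
proof -
  obtain C d where *: "\<forall>B\<ge>1. f B \<le> C * B ^ d" using assms by blast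
  have "B * f B \<le> C * B ^ Suc d" if "B \<ge> 1" for B
    using mult_le_mono2[OF *[rule_format, OF that], of B] by (simp add: algebra_simps)
  then show ?thesis by blast
qed

text \<open>Only \<open>XRed\<close> multiplies by \<open>B\<close>, and how often this is nested is
  fixed by the formula, so the degree does not depend on the input.\<close>

lemma time_poly: "\<exists>C d. \<forall>B\<ge>1. time e B \<le> C * B ^ d"
proof (induction e)
  case (XBin f a b)
  show ?case unfolding time.simps by (intro poly_bound_add poly_bound_const XBin.IH)
next
  case (XLess a b e f)
  show ?case unfolding time.simps by (intro poly_bound_add poly_bound_const XLess.IH)
next
  case (XNLess i j e f)
  show ?case unfolding time.simps by (intro poly_bound_add poly_bound_const XNLess.IH)
next
  case (XLet x a b)
  show ?case unfolding time.simps by (intro poly_bound_add poly_bound_const XLet.IH)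
next
  case (XRed f b v a e)
  show ?case unfolding time.simps
    by (intro poly_bound_add poly_bound_times poly_bound_const XRed.IH)
qed (simp_all only: time.simps poly_bound_const)

section \<open>Executions within a step budget, and the memory they leave intact\<close>

definition run :: "com \<Rightarrow> nat \<Rightarrow> state \<Rightarrow> state \<Rightarrow> bool" where
  "run c k s s' \<longleftrightarrow> (\<exists>k'\<le>k. exec c s k' s')"

lemma run_mono: "run c k s s' \<Longrightarrow> k \<le> k' \<Longrightarrow> run c k' s s'"
  unfolding run_def by (meson le_trans)

lemma run_Seq: "run c1 k1 s s' \<Longrightarrow> run c2 k2 s' s'' \<Longrightarrow> run (Seq c1 c2) (k1 + k2) s s''"
  unfolding run_def by (blast intro: exec.Seq add_mono)

lemma run_IfTrue: "bval b s \<Longrightarrow> run c1 k s s' \<Longrightarrow> k \<le> K \<Longrightarrow> run (IF b c1 c2) (Suc K) s s'"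
  unfolding run_def by (elim exE conjE, rule exI, rule conjI[rotated], erule (1) exec.IfTrue, simp)

lemma run_IfFalse: "\<not> bval b s \<Longrightarrow> run c2 k s s' \<Longrightarrow> k \<le> K \<Longrightarrow> run (IF b c1 c2) (Suc K) s s'"
  unfolding run_def by (elim exE conjE, rule exI, rule conjI[rotated], erule (1) exec.IfFalse, simp)

lemma run_NAssign: "run (NAssign v a) 1 s (set_nat v (nval a s) s)"
  unfolding run_def using exec.NAssign by blast

lemma run_RAssign: "run (RAssign v a b e) 1 s (set_real v (nval a s) (nval b s) (rval e s) s)"
  unfolding run_def using exec.RAssign by blast

lemma run_SKIP: "run SKIP 1 s s"
  unfolding run_def using exec.Skip by blast

lemma run_WhileFalse: "\<not> bval b s \<Longrightarrow> run (WHILE b c) 1 s s"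
  unfolding run_def using exec.WhileFalse by blast

lemma run_WhileTrue:
  "bval b s \<Longrightarrow> run c k1 s s' \<Longrightarrow> run (WHILE b c) k2 s' s'' \<Longrightarrow> run (WHILE b c) (Suc (k1 + k2)) s s''"
  unfolding run_def by (blast intro: exec.WhileTrue add_mono Suc_le_mono[THEN iffD2])

text \<open>Stack discipline: code at level \<open>d\<close> may overwrite only counters and rows of
  \<open>t\<close> from \<open>d\<close> upward, so enclosing computations and the input survive
  it.\<close>

definition frame :: "nat \<Rightarrow> state \<Rightarrow> state \<Rightarrow> bool" where
  "frame d s s' \<longleftrightarrow> (\<forall>x. x \<notin> slot ` {d..} \<longrightarrow> nats s' x = nats s x) \<and>
     (\<forall>x i j. \<not> (x = ''t'' \<and> i \<ge> d) \<longrightarrow> reals s' x i j = reals s x i j)"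

lemma slot_inj [simp]: "slot a = slot b \<longleftrightarrow> a = b"
  by (simp add: slot_def replicate_eq_replicate)

lemma frame_trans: "frame d s s' \<Longrightarrow> frame d s' s'' \<Longrightarrow> frame d s s''"
  by (simp add: frame_def)

lemma frame_refl: "frame d s s"
  by (simp add: frame_def)

lemma frame_antimono: "frame d s s' \<Longrightarrow> d' \<le> d \<Longrightarrow> frame d' s s'"
  by (auto simp: frame_def image_iff)

lemma frame_Suc: "frame (Suc d) s s' \<Longrightarrow> frame d s s'"
  by (rule frame_antimono) auto

lemma frame_set_real: "d \<le> i \<Longrightarrow> frame d s (set_real ''t'' i j a s)"
  by (auto simp: frame_def set_real_def)

lemma frame_set_nat: "d \<le> i \<Longrightarrow> frame d s (set_nat (slot i) a s)"
  by (auto simp: frame_def set_nat_def)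

lemma frame_nats: "frame d s s' \<Longrightarrow> i < d \<Longrightarrow> nats s' (slot i) = nats s (slot i)"
  unfolding frame_def by (drule conjunct1, erule allE[of _ "slot i"]) auto

lemma frame_reals: "frame d s s' \<Longrightarrow> i < d \<Longrightarrow> reals s' ''t'' i j = reals s ''t'' i j"
  by (auto simp: frame_def)

lemma bound_name_not_slot: "bound_name b \<noteq> slot d"
proof
  assume "bound_name b = slot d"
  then have "set (bound_name b) \<subseteq> {CHR ''i''}"
    by (auto simp: slot_def set_replicate_conv_if)
  then show False by (auto simp: bound_name_def split: if_splits)
qed

lemma frame_bound: "frame d s s' \<Longrightarrow> nats s' (bound_name b) = nats s (bound_name b)"
  unfolding frame_def using bound_name_not_slot by blast

lemma reals_set_real [simp]:
  "reals (set_real x i j a s) y k l = (if y = x \<and> k = i \<and> l = j then a else reals s y k l)"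
  by (simp add: set_real_def)

lemma nats_set_nat [simp]: "nats (set_nat x a s) y = (if y = x then a else nats s y)"
  by (simp add: set_nat_def)

lemma nats_set_real [simp]: "nats (set_real x i j a s) = nats s"
  by (simp add: set_real_def)

lemma reals_set_nat [simp]: "reals (set_nat x a s) = reals s"
  by (simp add: set_nat_def)

text \<open>The state represents the environments \<rho> and \<theta> of a formula at level
  \<open>d\<close>: all variables live strictly below \<open>d\<close>, out of reach of code framed
  at \<open>d\<close>, and the input is still that of \<open>s0\<close>.\<close>

definition matches ::
  "nat \<Rightarrow> (nat \<Rightarrow> nat) \<Rightarrow> (nat \<Rightarrow> nat) \<Rightarrow> (nat \<Rightarrow> nat) \<Rightarrow> (nat \<Rightarrow> real) \<Rightarrow> state \<Rightarrow> state \<Rightarrow> bool" where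
  "matches d \<eta> \<zeta> \<rho> \<theta> s0 s \<longleftrightarrow>
     (\<forall>v. \<eta> v < d \<and> nats s (slot (\<eta> v)) = \<rho> v) \<and>
     (\<forall>x. \<zeta> x < d \<and> reals s ''t'' (\<zeta> x) 0 = \<theta> x) \<and>
     (\<forall>b. nats s (bound_name b) = nats s0 (bound_name b)) \<and>
     (\<forall>x\<in>{''c'', ''r'', ''p''}. reals s x = reals s0 x)"

lemma matches_frame: "matches d \<eta> \<zeta> \<rho> \<theta> s0 s \<Longrightarrow> frame d s s' \<Longrightarrow> matches d \<eta> \<zeta> \<rho> \<theta> s0 s'"
  unfolding matches_def
  by (auto simp: frame_nats frame_reals frame_bound fun_eq_iff) (auto simp: frame_def)

lemma matches_Suc: "matches d \<eta> \<zeta> \<rho> \<theta> s0 s \<Longrightarrow> matches (Suc d) \<eta> \<zeta> \<rho> \<theta> s0 s"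
  unfolding matches_def by (auto simp: less_SucI)

section \<open>Correctness of compiled code\<close>

lemma set_tmp_correct:
  "\<exists>s'. run (set_tmp d e) 1 s s' \<and> frame d s s' \<and> reals s' ''t'' d 0 = rval e s"
  using run_RAssign[of "''t''" "NLit d" "NLit 0" e s]
  by (auto intro!: exI[of _ "set_real ''t'' d 0 (rval e s) s"] frame_set_real)

text \<open>The budget is 2 because maximum and minimum need a test before the assignment. That
  natural variables are unchanged is recorded separately: \<open>frame d\<close> alone would allow
  the loop counter \<open>slot d\<close> to be lost.\<close>

lemma apply_op_correct:
  "\<exists>s'. run (apply_op f d) 2 s s' \<and> frame d s s' \<and>
     reals s' ''t'' d 0 = aop_val f (reals s ''t'' d 0) (reals s ''t'' (Suc d) 0) \<and> nats s' = nats s"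
proof -
  have A: "\<exists>s'. run (set_tmp d e) 2 s s' \<and> frame d s s' \<and> reals s' ''t'' d 0 = rval e s \<and> nats s' = nats s" for e
    using run_mono[OF run_RAssign[of "''t''" "NLit d" "NLit 0" e s], of 2]
    by (auto intro!: exI[of _ "set_real ''t'' d 0 (rval e s) s"] frame_set_real)
  have B: "\<exists>s'. run (IF b (set_tmp d e) SKIP) 2 s s' \<and> frame d s s' \<and>
       reals s' ''t'' d 0 = (if bval b s then rval e s else reals s ''t'' d 0) \<and> nats s' = nats s" for b e
  proof (cases "bval b s")
    case True
    then show ?thesis
      using run_IfTrue[of b s "set_tmp d e" 1 _ 1] run_RAssign[of "''t''" "NLit d" "NLit 0" e s]
      by (auto simp: numeral_2_eq_2 intro!: exI[of _ "set_real ''t'' d 0 (rval e s) s"] frame_set_real)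
  next
    case False
    then show ?thesis
      using run_IfFalse[of b s SKIP 1 s 1] run_SKIP[of s]
      by (auto simp: numeral_2_eq_2 intro!: exI[of _ s] frame_refl)
  qed
  show ?thesis
    using A[of "RAdd (tmp d) (tmp (Suc d))"] A[of "RSub (tmp d) (tmp (Suc d))"]
      A[of "RMul (tmp d) (tmp (Suc d))"] A[of "RDiv (tmp d) (tmp (Suc d))"]
      B[of "RLess (tmp d) (tmp (Suc d))" "tmp (Suc d)"]
      B[of "RLess (tmp (Suc d)) (tmp d)" "tmp (Suc d)"]
    by (cases f) (auto simp: max_def min_def not_less split: if_splits)
qed

text \<open>Row \<open>d\<close> of \<open>t\<close> accumulates and \<open>slot d\<close> counts;
  the body runs at level \<open>Suc d\<close> and disturbs neither. The induction is on the number
  of rounds left, the counter being N + 1 at exit.\<close>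

lemma reduce_correct:
  assumes body: "\<And>i s. i \<in> {1..N} \<Longrightarrow> frame d s1 s \<Longrightarrow> nats s (slot d) = i \<Longrightarrow>
      \<exists>s'. run c T s s' \<and> frame (Suc d) s s' \<and> reals s' ''t'' (Suc d) 0 = g i"
    and N: "nats s1 (bound_name b) = N"
    and s: "frame d s1 s" "nats s (slot d) = i" "1 \<le> i" "i \<le> Suc N"
  shows "\<exists>s'. run (WHILE (NLess (NVar (slot d)) (NAdd (NVar (bound_name b)) (NLit 1)))
         (Seq c (Seq (apply_op f d) (NAssign (slot d) (NAdd (NVar (slot d)) (NLit 1)))))) 
         (1 + (Suc N - i) * (T + 4)) s s' \<and> frame d s1 s' \<and>
       reals s' ''t'' d 0 = fold (\<lambda>i y. aop_val f y (g i)) [i..<Suc N] (reals s ''t'' d 0)"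
  using s
proof (induction "Suc N - i" arbitrary: s i)
  case 0
  then have [simp]: "i = Suc N" by simp
  have "\<not> bval (NLess (NVar (slot d)) (NAdd (NVar (bound_name b)) (NLit 1))) s"
    using 0 N by (simp add: frame_bound[OF \<open>frame d s1 s\<close>])
  from run_WhileFalse[OF this] show ?case using 0 by auto
next
  case (Suc k)
  then have i: "i \<in> {1..N}" by auto
  let ?b = "NLess (NVar (slot d)) (NAdd (NVar (bound_name b)) (NLit 1))"
  obtain sa where sa: "run c T s sa" "frame (Suc d) s sa" "reals sa ''t'' (Suc d) 0 = g i"
    using body[OF i Suc.prems(1,2)] by blast
  obtain sb where sb: "run (apply_op f d) 2 sa sb" "frame d sa sb" "nats sb = nats sa"
      "reals sb ''t'' d 0 = aop_val f (reals sa ''t'' d 0) (reals sa ''t'' (Suc d) 0)"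
    using apply_op_correct by blast
  let ?sc = "set_nat (slot d) (Suc i) sb"
  have d: "nats sb (slot d) = i" using sb(3) frame_nats[OF sa(2)] Suc.prems(2) by simp
  have "run (NAssign (slot d) (NAdd (NVar (slot d)) (NLit 1))) 1 sb ?sc"
    using run_NAssign[of "slot d" "NAdd (NVar (slot d)) (NLit 1)" sb] d by simp
  from run_Seq[OF sa(1) run_Seq[OF sb(1) this]]
  have r: "run (Seq c (Seq (apply_op f d) (NAssign (slot d) (NAdd (NVar (slot d)) (NLit 1))))) (T + 3) s ?sc"
    by (simp add: numeral_eq_Suc)
  have fr: "frame d s1 ?sc"
    using Suc.prems(1) frame_Suc[OF sa(2)] sb(2) frame_set_nat[of d d] frame_trans by blast
  have "k = Suc N - Suc i" using Suc.hyps(2) by simp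
  from Suc.hyps(1)[OF this fr] obtain s' where s':
     "run (WHILE ?b
         (Seq c (Seq (apply_op f d) (NAssign (slot d) (NAdd (NVar (slot d)) (NLit 1)))))) 
         (1 + (Suc N - Suc i) * (T + 4)) ?sc s'" "frame d s1 s'"
       "reals s' ''t'' d 0 = fold (\<lambda>i y. aop_val f y (g i)) [Suc i..<Suc N] (reals ?sc ''t'' d 0)"
    using i by auto
  have "bval ?b s"
    using i N Suc.prems(2) by (simp add: frame_bound[OF Suc.prems(1)])
  from run_WhileTrue[OF this r s'(1)]
  have "run (WHILE ?b
         (Seq c (Seq (apply_op f d) (NAssign (slot d) (NAdd (NVar (slot d)) (NLit 1)))))) 
         (1 + (Suc N - i) * (T + 4)) s s'"
    by (rule run_mono) (use i in \<open>simp add: Suc_diff_le\<close>)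
  moreover have "[i..<Suc N] = i # [Suc i..<Suc N]" using i by (simp add: upt_conv_Cons)
  moreover have "reals ?sc ''t'' d 0 = aop_val f (reals s ''t'' d 0) (g i)"
    using sb(4) sa(3) frame_reals[OF sa(2)] by simp
  ultimately show ?case using s' by auto
qed

text \<open>Structural induction. A second operand is evaluated one level higher, so the first one
  survives in row \<open>d\<close> until both are combined.\<close>

lemma compile_correct:
  assumes "\<And>b. nats s0 (bound_name b) \<le> B" "matches d \<eta> \<zeta> \<rho> \<theta> s0 s"
  shows "\<exists>s'. run (compile e d \<eta> \<zeta>) (time e B) s s' \<and> frame d s s' \<and>
           reals s' ''t'' d 0 = fval s0 e \<rho> \<theta>"
  using assms(2)
proof (induction e arbitrary: d \<eta> \<zeta> \<rho> \<theta> s)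
  case (XBin f a b)
  obtain s1 where s1: "run (compile a d \<eta> \<zeta>) (time a B) s s1" "frame d s s1"
      "reals s1 ''t'' d 0 = fval s0 a \<rho> \<theta>"
    using XBin.IH(1)[OF XBin.prems] by blast
  obtain s2 where s2: "run (compile b (Suc d) \<eta> \<zeta>) (time b B) s1 s2" "frame (Suc d) s1 s2"
      "reals s2 ''t'' (Suc d) 0 = fval s0 b \<rho> \<theta>"
    using XBin.IH(2)[OF matches_Suc[OF matches_frame[OF XBin.prems s1(2)]]] by blast
  obtain s3 where s3: "run (apply_op f d) 2 s2 s3" "frame d s2 s3"
      "reals s3 ''t'' d 0 = aop_val f (reals s2 ''t'' d 0) (reals s2 ''t'' (Suc d) 0)"
    using apply_op_correct by blast
  have "run (compile (XBin f a b) d \<eta> \<zeta>) (time (XBin f a b) B) s s3"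
    using run_Seq[OF s1(1) run_Seq[OF s2(1) s3(1)]] by (simp add: add.assoc)
  moreover have "frame d s s3" using s1(2) frame_Suc[OF s2(2)] s3(2) frame_trans by blast
  ultimately show ?case using s1(3) s2(3) s3(3) frame_reals[OF s2(2)] by (intro exI[of _ s3]) simp
next
  case (XLess a b e f)
  obtain s1 where s1: "run (compile a d \<eta> \<zeta>) (time a B) s s1" "frame d s s1"
      "reals s1 ''t'' d 0 = fval s0 a \<rho> \<theta>"
    using XLess.IH(1)[OF XLess.prems] by blast
  obtain s2 where s2: "run (compile b (Suc d) \<eta> \<zeta>) (time b B) s1 s2" "frame (Suc d) s1 s2"
      "reals s2 ''t'' (Suc d) 0 = fval s0 b \<rho> \<theta>"
    using XLess.IH(2)[OF matches_Suc[OF matches_frame[OF XLess.prems s1(2)]]] by blast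
  have f2: "frame d s s2" using s1(2) frame_Suc[OF s2(2)] frame_trans by blast
  have v: "bval (RLess (tmp d) (tmp (Suc d))) s2 \<longleftrightarrow> fval s0 a \<rho> \<theta> < fval s0 b \<rho> \<theta>"
    using s1(3) s2(3) frame_reals[OF s2(2)] by simp
  note m = matches_frame[OF XLess.prems f2]
  have "\<exists>s3. run (IF (RLess (tmp d) (tmp (Suc d))) (compile e d \<eta> \<zeta>) (compile f d \<eta> \<zeta>))
       (Suc (time e B + time f B)) s2 s3 \<and> frame d s2 s3 \<and>
       reals s3 ''t'' d 0 = fval s0 (XLess a b e f) \<rho> \<theta>"
  proof (cases "fval s0 a \<rho> \<theta> < fval s0 b \<rho> \<theta>")
    case True
    obtain s3 where "run (compile e d \<eta> \<zeta>) (time e B) s2 s3" "frame d s2 s3"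
        "reals s3 ''t'' d 0 = fval s0 e \<rho> \<theta>"
      using XLess.IH(3)[OF m] by blast
    then show ?thesis using True v run_IfTrue[of _ s2 "compile e d \<eta> \<zeta>" "time e B" s3] by (auto intro!: exI[of _ s3])
  next
    case False
    obtain s3 where "run (compile f d \<eta> \<zeta>) (time f B) s2 s3" "frame d s2 s3"
        "reals s3 ''t'' d 0 = fval s0 f \<rho> \<theta>"
      using XLess.IH(4)[OF m] by blast
    then show ?thesis using False v run_IfFalse[of _ s2 "compile f d \<eta> \<zeta>" "time f B" s3] by (auto intro!: exI[of _ s3])
  qed
  then obtain s3 where s3: "run (IF (RLess (tmp d) (tmp (Suc d))) (compile e d \<eta> \<zeta>) (compile f d \<eta> \<zeta>))
       (Suc (time e B + time f B)) s2 s3" "frame d s2 s3"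
       "reals s3 ''t'' d 0 = fval s0 (XLess a b e f) \<rho> \<theta>"
    by blast
  have "run (compile (XLess a b e f) d \<eta> \<zeta>) (time (XLess a b e f) B) s s3"
    using run_Seq[OF s1(1) run_Seq[OF s2(1) s3(1)]] by (simp add: add.assoc)
  then show ?case using s3 f2 frame_trans by blast
next
  case (XNLess i j e f)
  let ?b = "NLess (NVar (slot (\<eta> i))) (NVar (slot (\<eta> j)))"
  have v: "bval ?b s \<longleftrightarrow> \<rho> i < \<rho> j"
    using XNLess.prems by (simp add: matches_def)
  show ?case
  proof (cases "\<rho> i < \<rho> j")
    case True
    obtain s3 where "run (compile e d \<eta> \<zeta>) (time e B) s s3" "frame d s s3"
        "reals s3 ''t'' d 0 = fval s0 e \<rho> \<theta>"
      using XNLess.IH(1)[OF XNLess.prems] by blast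
    then show ?thesis using True v run_IfTrue[of ?b s "compile e d \<eta> \<zeta>" "time e B" s3] by (auto intro!: exI[of _ s3])
  next
    case False
    obtain s3 where "run (compile f d \<eta> \<zeta>) (time f B) s s3" "frame d s s3"
        "reals s3 ''t'' d 0 = fval s0 f \<rho> \<theta>"
      using XNLess.IH(2)[OF XNLess.prems] by blast
    then show ?thesis using False v run_IfFalse[of ?b s "compile f d \<eta> \<zeta>" "time f B" s3] by (auto intro!: exI[of _ s3])
  qed
next
  case (XLet x a b)
  obtain s1 where s1: "run (compile a d \<eta> \<zeta>) (time a B) s s1" "frame d s s1"
      "reals s1 ''t'' d 0 = fval s0 a \<rho> \<theta>"
    using XLet.IH(1)[OF XLet.prems] by blast
  \<comment> \<open>The bound variable stays in row \<open>d\<close>, so its scope is evaluated one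
    level up.\<close>
  have "matches (Suc d) \<eta> (\<zeta>(x := d)) \<rho> (\<theta>(x := fval s0 a \<rho> \<theta>)) s0 s1"
    using matches_Suc[OF matches_frame[OF XLet.prems s1(2)]] s1(3) by (simp add: matches_def)
  from XLet.IH(2)[OF this]
  obtain s2 where s2: "run (compile b (Suc d) \<eta> (\<zeta>(x := d))) (time b B) s1 s2" "frame (Suc d) s1 s2"
      "reals s2 ''t'' (Suc d) 0 = fval s0 (XLet x a b) \<rho> \<theta>"
    by (simp only: fval.simps) blast
  \<comment> \<open>The result is moved down onto the bound variable, whose scope has ended.\<close>
  let ?s = "set_real ''t'' d 0 (reals s2 ''t'' (Suc d) 0) s2"
  have s3: "run (set_tmp d (tmp (Suc d))) 1 s2 ?s"
    using run_RAssign[of "''t''" "NLit d" "NLit 0" "tmp (Suc d)" s2] by simp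
  have "run (compile (XLet x a b) d \<eta> \<zeta>) (time (XLet x a b) B) s ?s"
    using run_Seq[OF s1(1) run_Seq[OF s2(1) s3]] by (simp add: add.assoc)
  moreover have "frame d s ?s"
    using s1(2) frame_Suc[OF s2(2)] frame_set_real[of d d] frame_trans by blast
  ultimately show ?case using s2(3) by (intro exI[of _ ?s]) simp
next
  case (XRed f b v a e)
  let ?N = "nats s0 (bound_name b)"
  obtain s1 where s1: "run (compile a d \<eta> \<zeta>) (time a B) s s1" "frame d s s1"
      "reals s1 ''t'' d 0 = fval s0 a \<rho> \<theta>"
    using XRed.IH(1)[OF XRed.prems] by blast
  note m1 = matches_frame[OF XRed.prems s1(2)]
  let ?s2 = "set_nat (slot d) 1 s1"
  have s2: "run (NAssign (slot d) (NLit 1)) 1 s1 ?s2"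
    using run_NAssign[of "slot d" "NLit 1" s1] by simp
  \<comment> \<open>The loop counter in \<open>slot d\<close> itself represents the bound index
    variable.\<close>
  have body: "\<exists>s'. run (compile e (Suc d) (\<eta>(v := d)) \<zeta>) (time e B) t s' \<and> frame (Suc d) t s' \<and>
      reals s' ''t'' (Suc d) 0 = fval s0 e (\<rho>(v := i)) \<theta>"
    if "frame d s1 t" "nats t (slot d) = i" for i t
    by (rule XRed.IH(2))
       (use matches_Suc[OF matches_frame[OF m1 that(1)]] that(2) in \<open>simp add: matches_def\<close>)
  have N: "nats s1 (bound_name b) = ?N"
    using m1 by (simp add: matches_def)
  have "\<exists>s3. run (WHILE (NLess (NVar (slot d)) (NAdd (NVar (bound_name b)) (NLit 1)))
         (Seq (compile e (Suc d) (\<eta>(v := d)) \<zeta>)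
           (Seq (apply_op f d) (NAssign (slot d) (NAdd (NVar (slot d)) (NLit 1))))))
         (1 + (Suc ?N - 1) * (time e B + 4)) ?s2 s3 \<and> frame d s1 s3 \<and>
      reals s3 ''t'' d 0 =
         fold (\<lambda>i y. aop_val f y (fval s0 e (\<rho>(v := i)) \<theta>)) [1..<Suc ?N] (reals ?s2 ''t'' d 0)"
    by (rule reduce_correct[OF body N]) (use frame_set_nat[of d d] in auto)
  then obtain s3 where s3: "run (WHILE (NLess (NVar (slot d)) (NAdd (NVar (bound_name b)) (NLit 1)))
         (Seq (compile e (Suc d) (\<eta>(v := d)) \<zeta>)
           (Seq (apply_op f d) (NAssign (slot d) (NAdd (NVar (slot d)) (NLit 1))))))
         (1 + (Suc ?N - 1) * (time e B + 4)) ?s2 s3" "frame d s1 s3"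
      "reals s3 ''t'' d 0 =
         fold (\<lambda>i y. aop_val f y (fval s0 e (\<rho>(v := i)) \<theta>)) [1..<Suc ?N] (reals ?s2 ''t'' d 0)"
    by blast
  have "run (compile (XRed f b v a e) d \<eta> \<zeta>) (time (XRed f b v a e) B) s s3"
    unfolding compile.simps
    by (rule run_mono[OF run_Seq[OF s1(1) run_Seq[OF s2 s3(1)]]])
       (use assms(1)[of b] in \<open>simp\<close>)
  moreover have "frame d s s3" using s1(2) s3(2) frame_trans by blast
  ultimately show ?case using s3(3) s1(3) by (intro exI[of _ s3]) simp
next
  case (XLit k)
  then show ?case using set_tmp_correct[of d "RLit k" s] by auto
next
  case (XVar x)
  then show ?case using set_tmp_correct[of d "tmp (\<zeta> x)" s] by (simp add: matches_def)
next
  case (XCost i)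
  then show ?case
    using set_tmp_correct[of d "RCell ''c'' (NVar (slot (\<eta> i))) (NLit 0)" s] by (simp add: matches_def)
next
  case (XRew i)
  then show ?case
    using set_tmp_correct[of d "RCell ''r'' (NVar (slot (\<eta> i))) (NLit 0)" s] by (simp add: matches_def)
next
  case (XProb i j)
  then show ?case
    using set_tmp_correct[of d "RCell ''p'' (NVar (slot (\<eta> i))) (NVar (slot (\<eta> j)))" s]
    by (simp add: matches_def)
qed


section \<open>Strategies as dynamic programs\<close>

lemma length_history: "h \<in> histories I \<Longrightarrow> card (fst ` set h) = length h"
  using distinct_card[of "map fst h"] by (simp add: histories_def)

lemma Cons_histories:
  "(i, j) # h \<in> histories I \<longleftrightarrow> h \<in> histories I \<and> i \<in> actions I - fst ` set h \<and> j \<in> outcomes I"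
  by (auto simp: histories_def)

definition event :: "history \<Rightarrow> (nat \<Rightarrow> nat) set" where
  "event h = {x. \<forall>(i, j)\<in>set h. x i = j}"

lemma event_Cons: "event ((i, j) # h) = {x. x i = j} \<inter> event h"
  by (auto simp: event_def)

text \<open>Expected payoff still to come after history \<open>h\<close>, costs already paid being
  left out. It is used with \<open>length h + k = num_actions I\<close>, so that at k = 0 every
  action is taken and a strategy must halt.\<close>

fun continuation :: "seq_contract \<Rightarrow> (nat \<Rightarrow> real) \<Rightarrow> strategy \<Rightarrow> nat \<Rightarrow> history \<Rightarrow> real" where
  "continuation I t \<pi> 0 h = (case \<pi> h of Halt j \<Rightarrow> t j | Take i \<Rightarrow> 0)"
| "continuation I t \<pi> (Suc k) h =
     (case \<pi> h of Halt j \<Rightarrow> t j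
      | Take i \<Rightarrow> (\<Sum>j\<in>outcomes I. outcome_prob I i j * continuation I t \<pi> k ((i, j) # h)) - cost I i)"

definition payoff :: "seq_contract \<Rightarrow> (nat \<Rightarrow> real) \<Rightarrow> strategy \<Rightarrow> (nat \<Rightarrow> nat) \<Rightarrow> real" where
  "payoff I t \<pi> x = t (final_outcome I \<pi> x) - (\<Sum>i\<in>taken I \<pi> x. cost I i)"

locale contract_instance =
  fixes I :: seq_contract
  assumes valid: "valid_instance I" and indep: "independent_actions I"
begin

lemma finite_actions [simp]: "finite (actions I)" and finite_outcomes [simp]: "finite (outcomes I)"
  by (simp_all add: actions_def outcomes_def)

lemma card_actions: "card (actions I) = num_actions I"
  by (simp add: actions_def)

lemma one_in_outcomes: "1 \<in> outcomes I"
  using valid by (simp add: valid_instance_def outcomes_def)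

lemma reward_nonneg: "j \<in> outcomes I \<Longrightarrow> 0 \<le> reward I j"
  using valid one_in_outcomes mono_onD[of "outcomes I" "reward I" 1 j]
  by (auto simp: valid_instance_def outcomes_def)

lemma reward_one: "reward I 1 = 0"
  using valid by (simp add: valid_instance_def)

lemma cost_nonneg: "i \<in> actions I \<Longrightarrow> 0 \<le> cost I i"
  using valid by (simp add: valid_instance_def)

lemma in_outcomes: "x \<in> set_pmf (joint I) \<Longrightarrow> i \<in> actions I \<Longrightarrow> x i \<in> outcomes I"
  using valid by (simp add: valid_instance_def)

lemma outcome_prob_nonneg [simp]: "0 \<le> outcome_prob I i j"
  by (simp add: outcome_prob_def)

lemma sum_outcome_prob: "i \<in> actions I \<Longrightarrow> (\<Sum>j\<in>outcomes I. outcome_prob I i j) = 1"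
proof -
  assume i: "i \<in> actions I"
  have "(\<Sum>j\<in>outcomes I. outcome_prob I i j) =
      measure_pmf.prob (joint I) (\<Union>j\<in>outcomes I. {x. x i = j})"
    unfolding outcome_prob_def
    by (subst measure_pmf.finite_measure_finite_Union) (auto simp: disjoint_family_on_def)
  also have "\<dots> = 1"
    by (subst measure_pmf.prob_eq_1) (auto simp: AE_measure_pmf_iff in_outcomes i)
  finally show ?thesis .
qed

text \<open>Independence of the actions enters here: a history prescribes one value for each of
  several distinct coordinates.\<close>

lemma prob_event:
  assumes "h \<in> histories I"
  shows "measure_pmf.prob (joint I) (event h) = (\<Prod>(i, j)\<leftarrow>h. outcome_prob I i j)"
\<comment> \<open>The product rule for independent variables asks for a nonempty index set.\<close>
proof (cases "h = []")
  case True
  then show ?thesis by (simp add: event_def)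
next
  case False
  have dist: "distinct (map fst h)" and sub: "fst ` set h \<subseteq> actions I"
    using assms by (auto simp: histories_def)
  \<comment> \<open>The outcome recorded for an action is unique because the actions of a history
    are distinct.\<close>
  define g where "g i = the (map_of h i)" for i
  have g: "g i = j" if "(i, j) \<in> set h" for i j
    using that dist by (simp add: g_def)
  have "event h = (\<Inter>i\<in>fst ` set h. (\<lambda>x. x i) -` {g i} \<inter> space (measure_pmf (joint I)))"
    using False g by (force simp: event_def)
  then have "measure_pmf.prob (joint I) (event h) =
      (\<Prod>i\<in>fst ` set h. measure_pmf.prob (joint I) ((\<lambda>x. x i) -` {g i} \<inter> space (measure_pmf (joint I))))"
    using prob_space.indep_varsD[OF prob_space_measure_pmf indep[unfolded independent_actions_def], of "fst ` set h" "\<lambda>i. {g i}"]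
      False sub by simp
  also have "\<dots> = (\<Prod>i\<in>set (map fst h). outcome_prob I i (g i))"
    by (auto intro!: prod.cong simp: outcome_prob_def vimage_def)
  also have "\<dots> = (\<Prod>i\<leftarrow>map fst h. outcome_prob I i (g i))"
    by (rule prod.distinct_set_conv_list[OF dist])
  also have "\<dots> = (\<Prod>(i, j)\<leftarrow>h. outcome_prob I i j)"
    unfolding map_map by (intro arg_cong[where f = prod_list] map_cong) (auto simp: g)
  finally show ?thesis .
qed

lemma prob_event_Cons:
  assumes "(i, j) # h \<in> histories I"
  shows "measure_pmf.prob (joint I) (event ((i, j) # h)) =
    outcome_prob I i j * measure_pmf.prob (joint I) (event h)"
  using prob_event[OF assms] prob_event[of h] assms by (simp add: Cons_histories)

lemma decision:
  assumes "\<pi> \<in> strategies I" "h \<in> histories I"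
  shows "\<pi> h \<in> decisions I h"
  using assms by (auto simp: strategies_def PiE_def)

lemma Halt_outcome:
  assumes "\<pi> \<in> strategies I" "h \<in> histories I" "\<pi> h = Halt j"
  shows "j \<in> insert 1 (snd ` set h)" "j \<in> outcomes I"
  using decision[OF assms(1,2)] assms(2,3) one_in_outcomes
  by (auto simp: decisions_def histories_def)

lemma Take_action:
  assumes "\<pi> \<in> strategies I" "h \<in> histories I" "\<pi> h = Take i"
  shows "i \<in> actions I - fst ` set h"
  using decision[OF assms(1,2)] assms(3) by (auto simp: decisions_def)

lemma full_history_halts:
  assumes "\<pi> \<in> strategies I" "h \<in> histories I" "length h = num_actions I"
  obtains j where "\<pi> h = Halt j"
proof (cases "\<pi> h")
  case (Take i)
  have "fst ` set h = actions I"
    using assms(2,3) length_history[OF assms(2)]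
    by (intro card_subset_eq) (auto simp: card_actions histories_def)
  then show ?thesis using Take_action[OF assms(1,2) Take] by simp
qed

section \<open>Runs of a strategy and their expected payoff\<close>

lemma history_after_histories:
  assumes "\<pi> \<in> strategies I" "x \<in> set_pmf (joint I)"
  shows "history_after \<pi> x k \<in> histories I"
proof (induction k)
  case 0
  then show ?case by (simp add: histories_def)
next
  case (Suc k)
  show ?case
  proof (cases "\<pi> (history_after \<pi> x k)")
    case (Take i)
    then show ?thesis
      using Take_action[OF assms(1) Suc Take] Suc in_outcomes[OF assms(2), of i]
      by (simp add: Let_def Cons_histories)
  qed (use Suc in \<open>simp add: Let_def\<close>)
qed

lemma final_history_histories:
  "\<pi> \<in> strategies I \<Longrightarrow> x \<in> set_pmf (joint I) \<Longrightarrow> final_history I \<pi> x \<in> histories I"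
  by (simp add: final_history_def history_after_histories)

lemma length_history_after:
  "length (history_after \<pi> x k) \<le> k \<and>
    (length (history_after \<pi> x k) = k \<or> (\<exists>j. \<pi> (history_after \<pi> x k) = Halt j))"
  by (induction k) (auto simp: Let_def split: decision.splits)

lemma final_history_halts:
  assumes "\<pi> \<in> strategies I" "x \<in> set_pmf (joint I)"
  obtains j where "\<pi> (final_history I \<pi> x) = Halt j"
  using length_history_after[of \<pi> x "num_actions I"]
    full_history_halts[OF assms(1) final_history_histories[OF assms]]
  unfolding final_history_def by metis

lemma final_outcome_outcomes:
  assumes "\<pi> \<in> strategies I" "x \<in> set_pmf (joint I)"
  shows "final_outcome I \<pi> x \<in> outcomes I"
proof -
  obtain j where "\<pi> (final_history I \<pi> x) = Halt j" using final_history_halts[OF assms] .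
  then show ?thesis
    using Halt_outcome(2)[OF assms(1) final_history_histories[OF assms]]
    by (simp add: final_outcome_def)
qed

text \<open>Final histories range over a finite set almost surely, so every function of them is
  bounded.\<close>

lemma integrable_final:
  fixes G :: "history \<Rightarrow> real"
  assumes "\<pi> \<in> strategies I"
  shows "integrable (joint I) (\<lambda>x. indicator A x * G (final_history I \<pi> x))"
proof (rule measure_pmf.integrable_const_bound)
  show "AE x in joint I. norm (indicator A x * G (final_history I \<pi> x)) \<le> (\<Sum>h\<in>histories I. \<bar>G h\<bar>)"
  proof (rule AE_pmfI)
    fix x assume "x \<in> set_pmf (joint I)"
    then have "\<bar>G (final_history I \<pi> x)\<bar> \<le> (\<Sum>h\<in>histories I. \<bar>G h\<bar>)"
      using final_history_histories[OF assms] finite_histories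
      by (intro member_le_sum) auto
    then show "norm (indicator A x * G (final_history I \<pi> x)) \<le> (\<Sum>h\<in>histories I. \<bar>G h\<bar>)"
      by (auto simp: indicator_def split: if_splits)
  qed
qed simp

lemma payoff_final_history:
  "payoff I t \<pi> x = (\<lambda>h. t (case \<pi> h of Halt j \<Rightarrow> j) - (\<Sum>i\<in>fst ` set h. cost I i)) (final_history I \<pi> x)"
  by (simp add: payoff_def final_outcome_def taken_def)

lemma history_after_halt:
  "history_after \<pi> x k = h \<Longrightarrow> \<pi> h = Halt j \<Longrightarrow> history_after \<pi> x (k + l) = h"
  by (induction l) (auto simp: Let_def)

text \<open>Backward induction on the number \<open>k\<close> of steps left. Taking an action splits
  the event of \<open>h\<close> according to the observed outcome, and the probabilities of the
  pieces factor. Restricting the expectation to the event, rather than conditioning on it, avoids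
  division by null probabilities.\<close>

lemma expectation_payoff_event:
  assumes pi: "\<pi> \<in> strategies I" and "h \<in> histories I" "length h + k = num_actions I"
    and "\<And>x. x \<in> event h \<Longrightarrow> history_after \<pi> x (length h) = h"
  shows "measure_pmf.expectation (joint I) (\<lambda>x. indicator (event h) x * payoff I t \<pi> x) =
    measure_pmf.prob (joint I) (event h) * (continuation I t \<pi> k h - (\<Sum>i\<in>fst ` set h. cost I i))"
proof -
  \<comment> \<open>Covers both the forced halt at k = 0 and an early halt.\<close>
  have halt: "measure_pmf.expectation (joint I) (\<lambda>x. indicator (event h) x * payoff I t \<pi> x) =
      measure_pmf.prob (joint I) (event h) * (t j - (\<Sum>i\<in>fst ` set h. cost I i))"
    if "length h + k = num_actions I" "\<pi> h = Halt j"
      "\<And>x. x \<in> event h \<Longrightarrow> history_after \<pi> x (length h) = h" for h k j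
  proof -
    have eq: "indicator (event h) x * payoff I t \<pi> x =
        indicator (event h) x * (t j - (\<Sum>i\<in>fst ` set h. cost I i))" for x
    proof (cases "x \<in> event h")
      case True
      then have "final_history I \<pi> x = h"
        using history_after_halt[OF that(3) that(2), of x k] that(1) by (simp add: final_history_def)
      then show ?thesis using that(2) by (simp add: payoff_final_history)
    qed simp
    show ?thesis unfolding eq by simp
  qed
  show ?thesis
    using assms(2-4)
  proof (induction k arbitrary: h)
    case 0
    then obtain j where "\<pi> h = Halt j" using full_history_halts[OF pi, of h] by auto
    then show ?case using halt[of h 0 j] 0 by simp
  next
    case (Suc k)
    show ?case
    proof (cases "\<pi> h")
      case (Halt j)
      then show ?thesis using halt[of h "Suc k" j] Suc.prems by simp
    next
      case (Take i)
      note i = Take_action[OF pi Suc.prems(1) Take]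
      let ?E = "measure_pmf.expectation (joint I)" and ?P = "measure_pmf.prob (joint I)"
      let ?C = "\<Sum>i\<in>fst ` set h. cost I i"
      \<comment> \<open>For each x only the summand for the realized outcome \<open>x i\<close>
        survives.\<close>
      have split: "indicator (event h) x * payoff I t \<pi> x =
          (\<Sum>j\<in>outcomes I. indicator (event ((i, j) # h)) x * payoff I t \<pi> x)"
        if "x \<in> set_pmf (joint I)" for x
      proof -
        have "indicator (event ((i, j) # h)) x * payoff I t \<pi> x =
            (if j = x i then indicator (event h) x * payoff I t \<pi> x else 0)" for j
          by (auto simp: event_Cons indicator_def)
        then show ?thesis using in_outcomes[OF that, of i] i by simp
      qed
      have step: "?E (\<lambda>x. indicator (event ((i, j) # h)) x * payoff I t \<pi> x) =
          ?P (event h) * (outcome_prob I i j * (continuation I t \<pi> k ((i, j) # h) - ?C - cost I i))"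
        if "j \<in> outcomes I" for j
      proof -
        have h': "(i, j) # h \<in> histories I"
          using Suc.prems(1) i that by (simp add: Cons_histories)
        have "history_after \<pi> x (length ((i, j) # h)) = (i, j) # h" if "x \<in> event ((i, j) # h)" for x
          using that Suc.prems(3)[of x] Take by (simp add: event_Cons Let_def)
        moreover have "(\<Sum>i\<in>fst ` set ((i, j) # h). cost I i) = cost I i + ?C"
          using i by simp
        ultimately show ?thesis
          using Suc.IH[OF h'] Suc.prems(2) prob_event_Cons[OF h'] by (simp add: algebra_simps)
      qed
      have "?E (\<lambda>x. indicator (event h) x * payoff I t \<pi> x) =
          ?E (\<lambda>x. \<Sum>j\<in>outcomes I. indicator (event ((i, j) # h)) x * payoff I t \<pi> x)"
        using split by (intro integral_cong_AE) (auto simp: AE_measure_pmf_iff)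
      also have "\<dots> = (\<Sum>j\<in>outcomes I. ?E (\<lambda>x. indicator (event ((i, j) # h)) x * payoff I t \<pi> x))"
        unfolding payoff_final_history
        by (intro Bochner_Integration.integral_sum integrable_final[OF pi])
      also have "\<dots> = ?P (event h) *
          (\<Sum>j\<in>outcomes I. outcome_prob I i j * (continuation I t \<pi> k ((i, j) # h) - ?C - cost I i))"
        by (simp add: step sum_distrib_left)
      also have "(\<Sum>j\<in>outcomes I. outcome_prob I i j * (continuation I t \<pi> k ((i, j) # h) - ?C - cost I i)) =
          continuation I t \<pi> (Suc k) h - ?C"
        using sum_outcome_prob[of i] i Take
        by (simp add: right_diff_distrib sum_subtractf sum_distrib_right[symmetric])
      finally show ?thesis .
    qed
  qed
qed

lemma agent_utility_continuation:
  assumes "\<pi> \<in> strategies I"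
  shows "agent_utility I t \<pi> = continuation I t \<pi> (num_actions I) []"
proof -
  have E: "event [] = UNIV" by (simp add: event_def)
  show ?thesis
    using expectation_payoff_event[OF assms, of "[]" "num_actions I" t]
    by (simp add: histories_def E agent_utility_def payoff_def)
qed

section \<open>Utilities under linear contracts\<close>

definition expected_reward :: "strategy \<Rightarrow> real" where
  "expected_reward \<pi> = measure_pmf.expectation (joint I) (\<lambda>x. reward I (final_outcome I \<pi> x))"

definition expected_cost :: "strategy \<Rightarrow> real" where
  "expected_cost \<pi> = measure_pmf.expectation (joint I) (\<lambda>x. \<Sum>i\<in>taken I \<pi> x. cost I i)"

text \<open>Each strategy thus contributes a line in \<alpha> whose slope is its expected reward;
  the agent maximizes over these lines.\<close>

lemma agent_utility_linear:
  assumes "\<pi> \<in> strategies I"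
  shows "agent_utility I (linear_contract I \<alpha>) \<pi> = \<alpha> * expected_reward \<pi> - expected_cost \<pi>"
proof -
  have "integrable (joint I) (\<lambda>x. reward I (final_outcome I \<pi> x))"
    using integrable_final[OF assms, of UNIV "\<lambda>h. reward I (case \<pi> h of Halt j \<Rightarrow> j)"]
    by (simp add: final_outcome_def)
  moreover have "integrable (joint I) (\<lambda>x. \<Sum>i\<in>taken I \<pi> x. cost I i)"
    using integrable_final[OF assms, of UNIV "\<lambda>h. \<Sum>i\<in>fst ` set h. cost I i"]
    by (simp add: taken_def)
  ultimately show ?thesis
    by (simp add: agent_utility_def linear_contract_def expected_reward_def expected_cost_def)
qed

lemma principal_utility_linear:
  "principal_utility I (linear_contract I \<alpha>) \<pi> = (1 - \<alpha>) * expected_reward \<pi>"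
proof -
  have "reward I j - linear_contract I \<alpha> j = (1 - \<alpha>) * reward I j" for j
    by (simp add: linear_contract_def algebra_simps)
  then show ?thesis by (simp add: principal_utility_def expected_reward_def)
qed

lemma expected_reward_nonneg:
  assumes "\<pi> \<in> strategies I"
  shows "0 \<le> expected_reward \<pi>"
  unfolding expected_reward_def
  by (rule integral_nonneg_AE)
     (auto simp: AE_measure_pmf_iff reward_nonneg final_outcome_outcomes[OF assms])

end


section \<open>Weitzman's index policy\<close>

context contract_instance begin

definition tail_prob :: "nat \<Rightarrow> nat \<Rightarrow> real" where
  "tail_prob i l = (\<Sum>j\<in>{j\<in>outcomes I. l \<le> j}. outcome_prob I i j)"

definition tail_reward :: "nat \<Rightarrow> nat \<Rightarrow> real" where
  "tail_reward i l = (\<Sum>j\<in>{j\<in>outcomes I. l \<le> j}. outcome_prob I i j * reward I j)"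

text \<open>The solution \<sigma> of \<alpha> A - \<sigma> P = c: the reservation equation under the
  guess that exactly the outcomes from l on are worth more than \<sigma>.\<close>

definition index_line :: "real \<Rightarrow> nat \<Rightarrow> nat \<Rightarrow> real" where
  "index_line \<alpha> i l = (\<alpha> * tail_reward i l - cost I i) / tail_prob i l"

definition index :: "real \<Rightarrow> nat \<Rightarrow> real" where
  "index \<alpha> i = Max (index_line \<alpha> i ` {l\<in>outcomes I. 0 < tail_prob i l})"

definition capped :: "real \<Rightarrow> nat \<Rightarrow> nat \<Rightarrow> real" where
  "capped \<alpha> i j = min (\<alpha> * reward I j) (index \<alpha> i)"

lemma tail_prob_one: "i \<in> actions I \<Longrightarrow> tail_prob i 1 = 1"
proof -
  assume "i \<in> actions I"
  moreover have "{j \<in> outcomes I. 1 \<le> j} = outcomes I" by (auto simp: outcomes_def)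
  ultimately show ?thesis by (simp only: tail_prob_def sum_outcome_prob)
qed

lemma tail_reward_nonneg: "0 \<le> tail_reward i l"
  unfolding tail_reward_def by (rule sum_nonneg) (simp add: reward_nonneg)

lemma index_lines_nonempty: "i \<in> actions I \<Longrightarrow> {l\<in>outcomes I. 0 < tail_prob i l} \<noteq> {}"
  using one_in_outcomes tail_prob_one[of i] by force

lemma index_line_le_index:
  "l \<in> outcomes I \<Longrightarrow> 0 < tail_prob i l \<Longrightarrow> index_line \<alpha> i l \<le> index \<alpha> i"
  unfolding index_def by (rule Max_ge) auto

lemma index_attained:
  assumes "i \<in> actions I"
  obtains l where "l \<in> outcomes I" "0 < tail_prob i l" "index \<alpha> i = index_line \<alpha> i l"
proof -
  have "index \<alpha> i \<in> index_line \<alpha> i ` {l\<in>outcomes I. 0 < tail_prob i l}"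
    unfolding index_def using index_lines_nonempty[OF assms] by (intro Max_in) auto
  then show ?thesis using that by blast
qed

text \<open>The sum of positive parts is at least the plain sum over the tail of an attaining line,
  which equals the cost. Conversely, the positive parts live on a single tail, and the index is at
  least the line of that tail.\<close>

lemma index_reservation:
  assumes \<alpha>: "0 \<le> \<alpha>" and i: "i \<in> actions I"
  shows "(\<Sum>j\<in>outcomes I. outcome_prob I i j * max 0 (\<alpha> * reward I j - index \<alpha> i)) = cost I i"
    (is "?h = _")
proof (rule antisym)
  let ?\<sigma> = "index \<alpha> i"
  have tail: "(\<Sum>j\<in>{j\<in>outcomes I. l \<le> j}. outcome_prob I i j * (\<alpha> * reward I j - ?\<sigma>)) =
      \<alpha> * tail_reward i l - ?\<sigma> * tail_prob i l" for l
    by (simp add: tail_reward_def tail_prob_def right_diff_distrib sum_subtractf sum_distrib_left mult_ac)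
  show "cost I i \<le> ?h"
  proof -
    obtain l where l: "l \<in> outcomes I" "0 < tail_prob i l" "?\<sigma> = index_line \<alpha> i l"
      using index_attained[OF i] .
    then have "cost I i = \<alpha> * tail_reward i l - ?\<sigma> * tail_prob i l"
      by (simp add: index_line_def)
    also have "\<dots> \<le> (\<Sum>j\<in>{j\<in>outcomes I. l \<le> j}. outcome_prob I i j * max 0 (\<alpha> * reward I j - ?\<sigma>))"
      unfolding tail[symmetric] by (intro sum_mono mult_left_mono) auto
    also have "\<dots> \<le> ?h"
      by (rule sum_mono2) auto
    finally show ?thesis .
  qed
  show "?h \<le> cost I i"
  proof (cases "\<exists>j\<in>outcomes I. ?\<sigma> < \<alpha> * reward I j")
    case False
    then have "?h = 0" by (intro sum.neutral) (auto simp: max_def not_less)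
    then show ?thesis using cost_nonneg[OF i] by simp
  next
    case True
    let ?J = "{j\<in>outcomes I. ?\<sigma> < \<alpha> * reward I j}"
    define l where "l = Min ?J"
    have l: "l \<in> ?J" unfolding l_def using True by (intro Min_in) auto
    \<comment> \<open>Rewards are monotone and \<alpha> \<ge> 0, so the outcomes worth more than the
      index form a tail.\<close>
    have J: "?J = {j\<in>outcomes I. l \<le> j}"
    proof
      show "?J \<subseteq> {j\<in>outcomes I. l \<le> j}" by (auto simp: l_def)
      show "{j\<in>outcomes I. l \<le> j} \<subseteq> ?J"
      proof
        fix j assume j: "j \<in> {j\<in>outcomes I. l \<le> j}"
        then have "reward I l \<le> reward I j"
          using valid l by (auto simp: valid_instance_def intro: mono_onD)
        then show "j \<in> ?J" using mult_left_mono[OF _ \<alpha>, of "reward I l" "reward I j"] l j by auto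
      qed
    qed
    have "?h = (\<Sum>j\<in>?J. outcome_prob I i j * max 0 (\<alpha> * reward I j - ?\<sigma>))"
      by (rule sum.mono_neutral_right) (auto simp: max_def)
    also have "\<dots> = (\<Sum>j\<in>?J. outcome_prob I i j * (\<alpha> * reward I j - ?\<sigma>))"
      by (rule sum.cong) auto
    also have "\<dots> = \<alpha> * tail_reward i l - ?\<sigma> * tail_prob i l"
      unfolding J tail ..
    also have "\<dots> \<le> cost I i"
    proof (cases "0 < tail_prob i l")
      case True
      then show ?thesis
        using index_line_le_index[of l i \<alpha>] l by (simp add: index_line_def divide_le_eq)
    next
      \<comment> \<open>A null tail defines no line, but its expected reward vanishes as
        well.\<close>
      case False
      then have 0: "tail_prob i l = 0"
        by (metis tail_prob_def outcome_prob_nonneg sum_nonneg less_eq_real_def)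
      then have "\<forall>j\<in>{j\<in>outcomes I. l \<le> j}. outcome_prob I i j = 0"
        unfolding tail_prob_def by (subst (asm) sum_nonneg_eq_0_iff) auto
      then have "tail_reward i l = 0" unfolding tail_reward_def by (intro sum.neutral) auto
      then show ?thesis using 0 cost_nonneg[OF i] by simp
    qed
    finally show ?thesis .
  qed
qed

section \<open>Expected maximum of capped values\<close>

definition open_box :: "real \<Rightarrow> nat \<Rightarrow> (real \<Rightarrow> real) \<Rightarrow> real \<Rightarrow> real" where
  "open_box \<alpha> i f y = (\<Sum>j\<in>outcomes I. outcome_prob I i j * f (max y (capped \<alpha> i j)))"

text \<open>Finite sums are swapped and maxima reordered. This makes \<open>Finite_Set.fold\<close>
  over a set of boxes independent of their order.\<close>

lemma open_box_commute: "open_box \<alpha> i \<circ> open_box \<alpha> k = open_box \<alpha> k \<circ> open_box \<alpha> i"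
proof (rule ext, rule ext)
  fix f y
  have "(open_box \<alpha> i \<circ> open_box \<alpha> k) f y = (\<Sum>j\<in>outcomes I. \<Sum>l\<in>outcomes I.
      outcome_prob I i j * (outcome_prob I k l * f (max (max y (capped \<alpha> i j)) (capped \<alpha> k l))))"
    by (simp add: open_box_def sum_distrib_left)
  also have "\<dots> = (\<Sum>l\<in>outcomes I. \<Sum>j\<in>outcomes I.
      outcome_prob I i j * (outcome_prob I k l * f (max (max y (capped \<alpha> i j)) (capped \<alpha> k l))))"
    by (rule sum.swap)
  also have "\<dots> = (open_box \<alpha> k \<circ> open_box \<alpha> i) f y"
    by (simp add: open_box_def sum_distrib_left max.assoc max.commute max.left_commute mult.left_commute)
  finally show "(open_box \<alpha> i \<circ> open_box \<alpha> k) f y = (open_box \<alpha> k \<circ> open_box \<alpha> i) f y" .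
qed

text \<open>\<open>expected_max \<alpha> S y\<close> is the expectation of the maximum of \<open>y\<close> and the capped values of the boxes in \<open>S\<close>.\<close>

definition expected_max :: "real \<Rightarrow> nat set \<Rightarrow> real \<Rightarrow> real" where
  "expected_max \<alpha> S = Finite_Set.fold (open_box \<alpha>) (\<lambda>y. y) S"

lemma expected_max_empty: "expected_max \<alpha> {} y = y"
  by (simp add: expected_max_def)

lemma expected_max_insert:
  assumes "finite S" "i \<notin> S"
  shows "expected_max \<alpha> (insert i S) = open_box \<alpha> i (expected_max \<alpha> S)"
proof -
  interpret comp_fun_commute "open_box \<alpha>"
    by standard (rule open_box_commute)
  show ?thesis using assms by (simp add: expected_max_def)
qed

lemma expected_max_remove:
  assumes "finite S" "i \<in> S"
  shows "expected_max \<alpha> S = open_box \<alpha> i (expected_max \<alpha> (S - {i}))"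
  using expected_max_insert[of "S - {i}" i \<alpha>] assms by (simp add: insert_absorb)

text \<open>Both bounds hold for max y w as a function of y and survive averaging with weights of
  sum 1.\<close>

lemma expected_max_Lipschitz:
  assumes "finite S" "S \<subseteq> actions I" "y \<le> z"
  shows "expected_max \<alpha> S y \<le> expected_max \<alpha> S z \<and>
    expected_max \<alpha> S z \<le> expected_max \<alpha> S y + (z - y)"
  using assms
proof (induction S arbitrary: y z)
  case empty
  then show ?case by (simp add: expected_max_empty)
next
  case (insert i S)
  let ?f = "expected_max \<alpha> S" and ?p = "outcome_prob I i"
  have step: "?f (max y w) \<le> ?f (max z w) \<and> ?f (max z w) \<le> ?f (max y w) + (z - y)" for w
  proof -
    have "max y w \<le> max z w" using insert.prems by auto
    from insert.IH[OF _ this] insert.prems show ?thesis by (smt (verit) insert_subset)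
  qed
  have "(\<Sum>j\<in>outcomes I. ?p j * (?f (max y (capped \<alpha> i j)) + (z - y))) = open_box \<alpha> i ?f y + (z - y)"
    using sum_outcome_prob[of i] insert.prems
    by (simp add: open_box_def distrib_left sum.distrib sum_distrib_right[symmetric])
  moreover have "open_box \<alpha> i ?f z \<le>
      (\<Sum>j\<in>outcomes I. ?p j * (?f (max y (capped \<alpha> i j)) + (z - y)))"
    unfolding open_box_def using step by (intro sum_mono mult_left_mono) auto
  moreover have "open_box \<alpha> i ?f y \<le> open_box \<alpha> i ?f z"
    unfolding open_box_def using step by (intro sum_mono mult_left_mono) auto
  ultimately show ?case using insert.hyps by (simp add: expected_max_insert)
qed

lemma expected_max_ge:
  assumes "finite S" "S \<subseteq> actions I"
  shows "y \<le> expected_max \<alpha> S y"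
  using assms
proof (induction S arbitrary: y)
  case empty
  then show ?case by (simp add: expected_max_empty)
next
  case (insert i S)
  have "y = (\<Sum>j\<in>outcomes I. outcome_prob I i j * y)"
    using sum_outcome_prob[of i] insert.prems by (simp add: sum_distrib_right[symmetric])
  also have "\<dots> \<le> open_box \<alpha> i (expected_max \<alpha> S) y"
    unfolding open_box_def
  proof (intro sum_mono mult_left_mono)
    fix j
    have "max y (capped \<alpha> i j) \<le> expected_max \<alpha> S (max y (capped \<alpha> i j))"
      using insert by simp
    then show "y \<le> expected_max \<alpha> S (max y (capped \<alpha> i j))" by simp
  qed simp
  finally show ?case using insert.hyps by (simp add: expected_max_insert)
qed

text \<open>A capped value never exceeds its index, so these boxes cannot raise y.\<close>

lemma expected_max_const:
  assumes "finite S" "S \<subseteq> actions I" "\<And>i. i \<in> S \<Longrightarrow> index \<alpha> i \<le> y"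
  shows "expected_max \<alpha> S y = y"
  using assms
proof (induction S)
  case empty
  then show ?case by (simp add: expected_max_empty)
next
  case (insert i S)
  have "max y (capped \<alpha> i j) = y" for j
    using insert.prems(2)[of i] by (simp add: capped_def max_def)
  moreover have "expected_max \<alpha> S y = y" using insert by simp
  ultimately have "open_box \<alpha> i (expected_max \<alpha> S) y = y"
    using sum_outcome_prob[of i] insert.prems
    by (simp add: open_box_def sum_distrib_right[symmetric])
  then show ?case using insert.hyps by (simp add: expected_max_insert)
qed

text \<open>The cost is traded for the expected excess over the index, which is how costs turn into
  caps.\<close>

lemma open_box_cost:
  assumes "0 \<le> \<alpha>" "i \<in> actions I"
  shows "(\<Sum>j\<in>outcomes I. outcome_prob I i j *
      (f (max y (capped \<alpha> i j)) + max 0 (\<alpha> * reward I j - index \<alpha> i))) =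
    open_box \<alpha> i f y + cost I i"
  using index_reservation[OF assms] by (simp add: open_box_def distrib_left sum.distrib)

text \<open>Seeing the true value instead of the capped one gains at most the excess over the index,
  by the Lipschitz bound, and the expected excess is exactly the cost. So no choice of a box beats
  \<open>expected_max\<close>.\<close>

lemma open_box_upper:
  assumes "0 \<le> \<alpha>" "finite S" "S \<subseteq> actions I" "i \<in> S"
  shows "(\<Sum>j\<in>outcomes I. outcome_prob I i j * expected_max \<alpha> (S - {i}) (max y (\<alpha> * reward I j))) - cost I i
    \<le> expected_max \<alpha> S y"
proof -
  let ?f = "expected_max \<alpha> (S - {i})"
  have "?f (max y (\<alpha> * reward I j)) \<le> ?f (max y (capped \<alpha> i j)) + max 0 (\<alpha> * reward I j - index \<alpha> i)" for j
  proof -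
    have le: "max y (capped \<alpha> i j) \<le> max y (\<alpha> * reward I j)"
      by (auto simp: capped_def)
    have "?f (max y (\<alpha> * reward I j)) \<le> ?f (max y (capped \<alpha> i j)) + (max y (\<alpha> * reward I j) - max y (capped \<alpha> i j))"
      using expected_max_Lipschitz[OF _ _ le, of "S - {i}"] assms by auto
    also have "max y (\<alpha> * reward I j) - max y (capped \<alpha> i j) \<le> max 0 (\<alpha> * reward I j - index \<alpha> i)"
      by (auto simp: capped_def)
    finally show ?thesis by simp
  qed
  then have "(\<Sum>j\<in>outcomes I. outcome_prob I i j * ?f (max y (\<alpha> * reward I j))) \<le>
      (\<Sum>j\<in>outcomes I. outcome_prob I i j *
        (?f (max y (capped \<alpha> i j)) + max 0 (\<alpha> * reward I j - index \<alpha> i)))"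
    by (intro sum_mono mult_left_mono) auto
  then show ?thesis
    using open_box_cost[OF assms(1), of i ?f y] expected_max_remove[OF assms(2,4)] assms by auto
qed

text \<open>Equality in the previous bound. Up to the index the cap is inactive; beyond it the value
  exceeds all remaining indices, \<open>expected_max\<close> is the identity there, and the
  Lipschitz bound is attained.\<close>

lemma open_box_greedy:
  assumes "0 \<le> \<alpha>" "finite S" "S \<subseteq> actions I" "i \<in> S"
    and "y \<le> index \<alpha> i" "\<And>k. k \<in> S \<Longrightarrow> index \<alpha> k \<le> index \<alpha> i"
  shows "(\<Sum>j\<in>outcomes I. outcome_prob I i j * expected_max \<alpha> (S - {i}) (max y (\<alpha> * reward I j))) - cost I i
    = expected_max \<alpha> S y"
proof -
  let ?f = "expected_max \<alpha> (S - {i})"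
  have const: "?f z = z" if "index \<alpha> i \<le> z" for z
    using that assms by (intro expected_max_const) force+
  have "?f (max y (\<alpha> * reward I j)) = ?f (max y (capped \<alpha> i j)) + max 0 (\<alpha> * reward I j - index \<alpha> i)" for j
  proof (cases "\<alpha> * reward I j \<le> index \<alpha> i")
    case False
    then have "max y (\<alpha> * reward I j) = \<alpha> * reward I j" "max y (capped \<alpha> i j) = index \<alpha> i"
      using assms(5) by (auto simp: capped_def)
    then show ?thesis using False const by simp
  qed (simp add: capped_def)
  then have "(\<Sum>j\<in>outcomes I. outcome_prob I i j * ?f (max y (\<alpha> * reward I j))) =
      open_box \<alpha> i ?f y + cost I i"
    using open_box_cost[OF assms(1), of i ?f y] assms by auto
  then show ?thesis using expected_max_remove[OF assms(2,4)] by simp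
qed

section \<open>Optimality of the greedy strategy\<close>

primrec best :: "real \<Rightarrow> history \<Rightarrow> real" where
  "best \<alpha> [] = 0"
| "best \<alpha> (a # h) = max (best \<alpha> h) (\<alpha> * reward I (snd a))"

lemma best_ge: "j \<in> insert 1 (snd ` set h) \<Longrightarrow> \<alpha> * reward I j \<le> best \<alpha> h"
proof (induction h)
  case Nil
  then show ?case by (simp add: reward_one[simplified])
next
  case (Cons a h)
  then show ?case by (cases "j = snd a") (auto simp: le_max_iff_disj)
qed

lemma best_attained: "\<exists>j\<in>insert 1 (snd ` set h). \<alpha> * reward I j = best \<alpha> h"
proof (induction h)
  case Nil
  then show ?case by (simp add: reward_one[simplified])
next
  case (Cons a h)
  then obtain j where "j \<in> insert 1 (snd ` set h)" "\<alpha> * reward I j = best \<alpha> h" by blast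
  then show ?case
    by (cases "\<alpha> * reward I (snd a) \<le> best \<alpha> h") (auto simp: max_def)
qed

lemma continuation_le:
  assumes "0 \<le> \<alpha>" "\<pi> \<in> strategies I" "h \<in> histories I" "length h + k = num_actions I"
  shows "continuation I (linear_contract I \<alpha>) \<pi> k h \<le>
    expected_max \<alpha> (actions I - fst ` set h) (best \<alpha> h)"
  using assms(3,4)
proof (induction k arbitrary: h)
  case 0
  then obtain j where j: "\<pi> h = Halt j" using full_history_halts[OF assms(2), of h] by auto
  have "\<alpha> * reward I j \<le> best \<alpha> h" using Halt_outcome(1)[OF assms(2) 0(1) j] by (rule best_ge)
  then show ?case
    using j expected_max_ge[of "actions I - fst ` set h" "best \<alpha> h" \<alpha>]
    by (simp add: linear_contract_def)
next
  case (Suc k)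
  let ?S = "actions I - fst ` set h"
  show ?case
  proof (cases "\<pi> h")
    case (Halt j)
    have "\<alpha> * reward I j \<le> best \<alpha> h" using Halt_outcome(1)[OF assms(2) Suc(2) Halt] by (rule best_ge)
    then show ?thesis
      \<comment> \<open>Halting is within the bound since \<open>expected_max\<close> never falls
        below the best value seen.\<close>
      using Halt expected_max_ge[of ?S "best \<alpha> h" \<alpha>] by (simp add: linear_contract_def)
  next
    case (Take i)
    note i = Take_action[OF assms(2) Suc.prems(1) Take]
    have S: "actions I - insert i (fst ` set h) = ?S - {i}" by auto
    have "continuation I (linear_contract I \<alpha>) \<pi> k ((i, j) # h) \<le>
        expected_max \<alpha> (?S - {i}) (max (best \<alpha> h) (\<alpha> * reward I j))" if "j \<in> outcomes I" for j
      using Suc.IH[of "(i, j) # h"] Suc.prems i that by (simp add: Cons_histories S)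
    then have "(\<Sum>j\<in>outcomes I. outcome_prob I i j * continuation I (linear_contract I \<alpha>) \<pi> k ((i, j) # h)) \<le>
        (\<Sum>j\<in>outcomes I. outcome_prob I i j * expected_max \<alpha> (?S - {i}) (max (best \<alpha> h) (\<alpha> * reward I j)))"
      by (intro sum_mono mult_left_mono) auto
    then show ?thesis
      using Take open_box_upper[OF assms(1), of ?S i "best \<alpha> h"] i by auto
  qed
qed

text \<open>Weitzman's rule, with ties settled by Hilbert choice. Restriction to
  \<open>histories I\<close> makes it extensional, as \<open>strategies I\<close> requires.\<close>

definition greedy :: "real \<Rightarrow> strategy" where
  "greedy \<alpha> = (\<lambda>h\<in>histories I.
     let S = actions I - fst ` set h in
     if \<exists>i\<in>S. best \<alpha> h < index \<alpha> i
     then Take (SOME i. i \<in> S \<and> (\<forall>k\<in>S. index \<alpha> k \<le> index \<alpha> i))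
     else Halt (SOME j. j \<in> insert 1 (snd ` set h) \<and> \<alpha> * reward I j = best \<alpha> h))"

lemma greedy_cases:
  assumes "h \<in> histories I"
  obtains i where "greedy \<alpha> h = Take i" "i \<in> actions I - fst ` set h" "best \<alpha> h \<le> index \<alpha> i"
      "\<And>k. k \<in> actions I - fst ` set h \<Longrightarrow> index \<alpha> k \<le> index \<alpha> i"
    | j where "greedy \<alpha> h = Halt j" "j \<in> insert 1 (snd ` set h)" "\<alpha> * reward I j = best \<alpha> h"
      "\<And>k. k \<in> actions I - fst ` set h \<Longrightarrow> index \<alpha> k \<le> best \<alpha> h"
proof -
  let ?S = "actions I - fst ` set h"
  show ?thesis
  proof (cases "\<exists>i\<in>?S. best \<alpha> h < index \<alpha> i")
    case True
    then obtain k where k: "k \<in> ?S" "best \<alpha> h < index \<alpha> k" by blast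
    define i where "i = (SOME i. i \<in> ?S \<and> (\<forall>k\<in>?S. index \<alpha> k \<le> index \<alpha> i))"
    have "\<exists>i. i \<in> ?S \<and> (\<forall>k\<in>?S. index \<alpha> k \<le> index \<alpha> i)"
    proof -
      have "Max (index \<alpha> ` ?S) \<in> index \<alpha> ` ?S" by (rule Max_in) (use k in auto)
      then obtain i where i: "i \<in> ?S" "Max (index \<alpha> ` ?S) = index \<alpha> i" by blast
      have "index \<alpha> l \<le> index \<alpha> i" if "l \<in> ?S" for l
        unfolding i(2)[symmetric] by (rule Max_ge) (use that in auto)
      then show ?thesis using i(1) by blast
    qed
    from someI_ex[OF this] have i: "i \<in> ?S \<and> (\<forall>k\<in>?S. index \<alpha> k \<le> index \<alpha> i)"
      unfolding i_def .
    have "greedy \<alpha> h = Take i"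
      using assms True unfolding greedy_def i_def by (simp only: restrict_apply' Let_def if_True)
    then show ?thesis
    proof (rule that(1))
      show "best \<alpha> h \<le> index \<alpha> i" using i k by (meson less_imp_le less_le_trans)
    qed (use i in auto)
  next
    case False
    define j where "j = (SOME j. j \<in> insert 1 (snd ` set h) \<and> \<alpha> * reward I j = best \<alpha> h)"
    have "\<exists>j. j \<in> insert 1 (snd ` set h) \<and> \<alpha> * reward I j = best \<alpha> h"
      using best_attained by blast
    from someI_ex[OF this] have j: "j \<in> insert 1 (snd ` set h) \<and> \<alpha> * reward I j = best \<alpha> h"
      unfolding j_def .
    have "greedy \<alpha> h = Halt j"
      using assms False unfolding greedy_def j_def by (simp only: restrict_apply' Let_def if_False)
    then show ?thesis by (rule that(2)) (use j False in \<open>auto simp: not_less\<close>)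
  qed
qed

lemma greedy_strategies: "greedy \<alpha> \<in> strategies I"
  unfolding strategies_def
proof (rule PiE_I)
  fix h assume "h \<in> histories I"
  then show "greedy \<alpha> h \<in> decisions I h"
    by (cases rule: greedy_cases[of h \<alpha>]) (auto simp: decisions_def)
qed (simp add: greedy_def)

text \<open>The induction of \<open>continuation_le\<close> with equalities:
  \<open>open_box_greedy\<close> replaces the upper bound, and at a halt no remaining index exceeds
  the best value.\<close>

lemma greedy_continuation:
  assumes "0 \<le> \<alpha>" "h \<in> histories I" "length h + k = num_actions I"
  shows "continuation I (linear_contract I \<alpha>) (greedy \<alpha>) k h =
    expected_max \<alpha> (actions I - fst ` set h) (best \<alpha> h)"
  using assms(2,3)
proof (induction k arbitrary: h)
  case 0
  then obtain j where j: "greedy \<alpha> h = Halt j"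
    using full_history_halts[OF greedy_strategies, of h] by auto
  from 0(1) show ?case
  proof (cases rule: greedy_cases[of h \<alpha>])
    case (2 j)
    have "expected_max \<alpha> (actions I - fst ` set h) (best \<alpha> h) = best \<alpha> h"
      using 2(4) by (intro expected_max_const) auto
    then show ?thesis using 2 by (simp add: linear_contract_def)
  qed (use j in simp)
next
  case (Suc k)
  let ?S = "actions I - fst ` set h"
  from Suc.prems(1) show ?case
  proof (cases rule: greedy_cases[of h \<alpha>])
    case (2 j)
    have "expected_max \<alpha> ?S (best \<alpha> h) = best \<alpha> h"
      using 2(4) by (intro expected_max_const) auto
    then show ?thesis using 2 by (simp add: linear_contract_def)
  next
    case (1 i)
    have S: "actions I - insert i (fst ` set h) = ?S - {i}" by auto
    have "continuation I (linear_contract I \<alpha>) (greedy \<alpha>) k ((i, j) # h) =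
        expected_max \<alpha> (?S - {i}) (max (best \<alpha> h) (\<alpha> * reward I j))" if "j \<in> outcomes I" for j
      using Suc.IH[of "(i, j) # h"] Suc.prems 1 that by (simp add: Cons_histories S)
    then show ?thesis
      using 1 open_box_greedy[OF assms(1), of ?S i "best \<alpha> h"] by simp
  qed
qed

text \<open>This is U(\<alpha>): for \<alpha> \<ge> 0 the next two lemmas show that no strategy
  exceeds it and that the greedy one attains it.\<close>

definition agent_value :: "real \<Rightarrow> real" where
  "agent_value \<alpha> = expected_max \<alpha> (actions I) 0"

lemma agent_utility_le:
  "0 \<le> \<alpha> \<Longrightarrow> \<pi> \<in> strategies I \<Longrightarrow> agent_utility I (linear_contract I \<alpha>) \<pi> \<le> agent_value \<alpha>"
  using continuation_le[of \<alpha> \<pi> "[]" "num_actions I"]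
  by (simp add: agent_utility_continuation agent_value_def histories_def)

lemma agent_utility_greedy:
  "0 \<le> \<alpha> \<Longrightarrow> agent_utility I (linear_contract I \<alpha>) (greedy \<alpha>) = agent_value \<alpha>"
  using greedy_continuation[of \<alpha> "[]" "num_actions I"]
  by (simp add: agent_utility_continuation[OF greedy_strategies] agent_value_def histories_def)

end


section \<open>The agent value is piecewise linear in the contract parameter\<close>

lemma linear_root_between:
  fixes k e x y a b :: real
  assumes "k * x + e > 0" "k * y + e < 0" "x \<in> {a..b}" "y \<in> {a..b}"
  shows "a < - e / k \<and> - e / k < b"
proof -
  have "k \<noteq> 0" using assms(1,2) by auto
  then consider "k > 0" | "k < 0" by linarith
  then show ?thesis
  proof cases
    case 1
    then have "y < - e / k" "- e / k < x" using assms(1,2) by (auto simp: field_simps)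
    then show ?thesis using assms(3,4) by auto
  next
    case 2
    then have "x < - e / k" "- e / k < y" using assms(1,2) by (auto simp: field_simps)
    then show ?thesis using assms(3,4) by auto
  qed
qed

text \<open>Agreeing with one line of \<open>L\<close> on the whole interval is preserved by max and
  min when no two lines of \<open>L\<close> cross there; being merely affine is not.\<close>

definition on_line :: "(real \<times> real) set \<Rightarrow> real \<Rightarrow> real \<Rightarrow> (real \<Rightarrow> real) \<Rightarrow> bool" where
  "on_line L a b f \<longleftrightarrow> (\<exists>(s, t)\<in>L. \<forall>x\<in>{a..b}. f x = s * x + t)"

definition uncrossed :: "(real \<times> real) set \<Rightarrow> real \<Rightarrow> real \<Rightarrow> bool" where
  "uncrossed L a b \<longleftrightarrow> (\<forall>(s, t)\<in>L. \<forall>(s', t')\<in>L.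
     (\<forall>x\<in>{a..b}. s * x + t \<le> s' * x + t') \<or> (\<forall>x\<in>{a..b}. s' * x + t' \<le> s * x + t))"

lemma uncrossed_cases:
  assumes "uncrossed L a b" "on_line L a b f" "on_line L a b g"
  shows "(\<forall>x\<in>{a..b}. f x \<le> g x) \<or> (\<forall>x\<in>{a..b}. g x \<le> f x)"
proof -
  obtain s t where f: "(s, t) \<in> L" "\<forall>x\<in>{a..b}. f x = s * x + t"
    using assms(2) by (auto simp: on_line_def)
  obtain s' t' where g: "(s', t') \<in> L" "\<forall>x\<in>{a..b}. g x = s' * x + t'"
    using assms(3) by (auto simp: on_line_def)
  have "(\<forall>x\<in>{a..b}. s * x + t \<le> s' * x + t') \<or> (\<forall>x\<in>{a..b}. s' * x + t' \<le> s * x + t)"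
    using assms(1) f(1) g(1) unfolding uncrossed_def by fast
  then show ?thesis using f(2) g(2) by simp
qed

lemma on_line_cong: "on_line L a b f \<Longrightarrow> (\<And>x. x \<in> {a..b} \<Longrightarrow> g x = f x) \<Longrightarrow> on_line L a b g"
  unfolding on_line_def by auto

lemma on_line_max:
  assumes "uncrossed L a b" "on_line L a b f" "on_line L a b g"
  shows "on_line L a b (\<lambda>x. max (f x) (g x))"
  using uncrossed_cases[OF assms]
proof
  assume "\<forall>x\<in>{a..b}. f x \<le> g x"
  then show ?thesis by (intro on_line_cong[OF assms(3)]) (simp add: max_def)
next
  assume "\<forall>x\<in>{a..b}. g x \<le> f x"
  then show ?thesis by (intro on_line_cong[OF assms(2)]) (simp add: max_absorb1)
qed

lemma on_line_min:
  assumes "uncrossed L a b" "on_line L a b f" "on_line L a b g"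
  shows "on_line L a b (\<lambda>x. min (f x) (g x))"
  using uncrossed_cases[OF assms]
proof
  assume "\<forall>x\<in>{a..b}. f x \<le> g x"
  then show ?thesis by (intro on_line_cong[OF assms(2)]) (simp add: min_def)
next
  assume "\<forall>x\<in>{a..b}. g x \<le> f x"
  then show ?thesis by (intro on_line_cong[OF assms(3)]) (simp add: min_absorb2)
qed

lemma on_line_Max:
  assumes "uncrossed L a b" "finite F" "F \<noteq> {}" "\<And>l. l \<in> F \<Longrightarrow> on_line L a b (\<lambda>x. f x l)"
  shows "on_line L a b (\<lambda>x. Max (f x ` F))"
  using assms(2-4)
proof (induction F rule: finite_ne_induct)
  case (singleton l)
  then show ?case by simp
next
  case (insert l F)
  have "on_line L a b (\<lambda>x. max (f x l) (Max (f x ` F)))"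
    using insert by (intro on_line_max[OF assms(1)]) auto
  then show ?case using insert.hyps by simp
qed

text \<open>Expectations average several lines and so leave \<open>L\<close>; after sums only
  affinity can be claimed.\<close>

definition affine_between :: "real \<Rightarrow> real \<Rightarrow> (real \<Rightarrow> real) \<Rightarrow> bool" where
  "affine_between a b f \<longleftrightarrow> (\<exists>s t. \<forall>x\<in>{a..b}. f x = s * x + t)"

lemma on_line_affine: "on_line L a b f \<Longrightarrow> affine_between a b f"
  by (auto simp: on_line_def affine_between_def)

lemma affine_between_sum:
  assumes "finite J" "\<And>j. j \<in> J \<Longrightarrow> affine_between a b (f j)"
  shows "affine_between a b (\<lambda>x. \<Sum>j\<in>J. p j * f j x)"
proof -
  obtain s t where st: "\<And>j x. j \<in> J \<Longrightarrow> x \<in> {a..b} \<Longrightarrow> f j x = s j * x + t j"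
    using assms(2) unfolding affine_between_def by metis
  have "(\<Sum>j\<in>J. p j * f j x) = (\<Sum>j\<in>J. p j * s j) * x + (\<Sum>j\<in>J. p j * t j)" if "x \<in> {a..b}" for x
  proof -
    have "(\<Sum>j\<in>J. p j * f j x) = (\<Sum>j\<in>J. p j * s j * x + p j * t j)"
      using st[OF _ that] by (intro sum.cong) (simp_all add: algebra_simps)
    then show ?thesis by (simp add: sum.distrib sum_distrib_right)
  qed
  then show ?thesis unfolding affine_between_def by blast
qed

text \<open>Points outside the open unit interval, including the value 0 of a division by zero for
  parallel lines, are sent to 0, which has to be considered anyway.\<close>

definition clip :: "real \<Rightarrow> real" where
  "clip x = (if 0 < x \<and> x < 1 then x else 0)"

context contract_instance begin

section \<open>Crossing points as candidates for breakpoints\<close>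

definition line_slope :: "nat \<Rightarrow> nat \<Rightarrow> real" where
  "line_slope i l = tail_reward i l / tail_prob i l"

definition line_icpt :: "nat \<Rightarrow> nat \<Rightarrow> real" where
  "line_icpt i l = cost I i / tail_prob i l"

lemma index_line_eq: "index_line \<alpha> i l = line_slope i l * \<alpha> + - line_icpt i l"
  by (simp add: index_line_def line_slope_def line_icpt_def diff_divide_distrib mult.commute)

definition lines :: "(real \<times> real) set" where
  "lines = (\<lambda>j. (reward I j, 0)) ` outcomes I \<union>
     (\<lambda>(i, l). (line_slope i l, - line_icpt i l)) ` (actions I \<times> outcomes I)"

definition crossing :: "nat \<Rightarrow> nat \<Rightarrow> nat \<Rightarrow> nat \<Rightarrow> real" where
  "crossing i l i' l' = (line_icpt i l - line_icpt i' l') / (line_slope i l - line_slope i' l')"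

definition reward_crossing :: "nat \<Rightarrow> nat \<Rightarrow> nat \<Rightarrow> real" where
  "reward_crossing i l j = line_icpt i l / (line_slope i l - reward I j)"

text \<open>Both kinds of crossing share one index quadruple, so that a single nest of four loops
  enumerates them. Without actions the set is empty, hence 0 is adjoined separately later.\<close>

definition candidates :: "real set" where
  "candidates = (\<Union>i\<in>actions I. \<Union>l\<in>outcomes I. \<Union>i'\<in>actions I. \<Union>l'\<in>outcomes I.
     {clip (crossing i l i' l'), clip (reward_crossing i l l')})"

lemma finite_candidates [simp]: "finite candidates"
  unfolding candidates_def by (intro finite_UN_I finite_actions finite_outcomes) simp

lemma candidates_bounds: "x \<in> candidates \<Longrightarrow> 0 \<le> x \<and> x < 1"
  unfolding candidates_def by (auto simp: clip_def split: if_splits)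

lemma crossing_candidate:
  "i \<in> actions I \<Longrightarrow> l \<in> outcomes I \<Longrightarrow> i' \<in> actions I \<Longrightarrow> l' \<in> outcomes I \<Longrightarrow>
   0 < crossing i l i' l' \<Longrightarrow> crossing i l i' l' < 1 \<Longrightarrow> crossing i l i' l' \<in> candidates"
  unfolding candidates_def
  by (rule UN_I[where a = i], assumption, rule UN_I[where a = l], assumption,
      rule UN_I[where a = i'], assumption, rule UN_I[where a = l'], assumption)
     (auto simp: clip_def)

lemma reward_crossing_candidate:
  "i \<in> actions I \<Longrightarrow> l \<in> outcomes I \<Longrightarrow> j \<in> outcomes I \<Longrightarrow>
   0 < reward_crossing i l j \<Longrightarrow> reward_crossing i l j < 1 \<Longrightarrow> reward_crossing i l j \<in> candidates"
  unfolding candidates_def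
  by (rule UN_I[where a = i], assumption, rule UN_I[where a = l], assumption,
      rule UN_I[where a = i], assumption, rule UN_I[where a = j], assumption)
     (auto simp: clip_def)

lemma root_candidate:
  assumes "(s, t) \<in> lines" "(s', t') \<in> lines" "0 < - (t - t') / (s - s')" "- (t - t') / (s - s') < 1"
  shows "- (t - t') / (s - s') \<in> candidates"
proof -
  have cases: "(\<exists>j\<in>outcomes I. s = reward I j \<and> t = 0) \<or>
      (\<exists>i\<in>actions I. \<exists>l\<in>outcomes I. s = line_slope i l \<and> t = - line_icpt i l)"
    if "(s, t) \<in> lines" for s t
    using that by (auto simp: lines_def)
  from cases[OF assms(1)] show ?thesis
  proof (elim disjE bexE conjE)
    fix j assume j: "j \<in> outcomes I" "s = reward I j" "t = 0"
    from cases[OF assms(2)] show ?thesis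
    proof (elim disjE bexE conjE)
      \<comment> \<open>Two reward lines have root 0, which contradicts positivity.\<close>
      fix j' assume "t' = 0"
      then show ?thesis using assms(3) j by simp
    next
      fix i l assume *: "i \<in> actions I" "l \<in> outcomes I" "s' = line_slope i l" "t' = - line_icpt i l"
      \<comment> \<open>With the reward line first, numerator and denominator both change
        sign.\<close>
      have "- (t - t') / (s - s') = reward_crossing i l j"
        unfolding j * reward_crossing_def
        by (metis diff_0 minus_diff_eq minus_divide_divide minus_minus)
      then show ?thesis using reward_crossing_candidate[OF *(1,2) j(1)] assms(3,4) by simp
    qed
  next
    fix i l assume *: "i \<in> actions I" "l \<in> outcomes I" "s = line_slope i l" "t = - line_icpt i l"
    from cases[OF assms(2)] show ?thesis
    proof (elim disjE bexE conjE)
      fix j assume j: "j \<in> outcomes I" "s' = reward I j" "t' = 0"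
      have "- (t - t') / (s - s') = reward_crossing i l j"
        unfolding j * reward_crossing_def by simp
      then show ?thesis using reward_crossing_candidate[OF *(1,2) j(1)] assms(3,4) by simp
    next
      fix i' l' assume **: "i' \<in> actions I" "l' \<in> outcomes I" "s' = line_slope i' l'" "t' = - line_icpt i' l'"
      have "- (t - t') / (s - s') = crossing i l i' l'"
        unfolding ** * crossing_def by simp
      then show ?thesis using crossing_candidate[OF *(1,2) **(1,2)] assms(3,4) by simp
    qed
  qed
qed

text \<open>Two lines ordered differently at two points of the interval meet strictly inside it, and
  this meeting point would be a candidate.\<close>

lemma uncrossed_lines:
  assumes "0 \<le> a" "b \<le> 1" and no: "\<And>x. x \<in> candidates \<Longrightarrow> \<not> (a < x \<and> x < b)"
  shows "uncrossed lines a b"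
proof -
  have "(\<forall>x\<in>{a..b}. s * x + t \<le> s' * x + t') \<or> (\<forall>x\<in>{a..b}. s' * x + t' \<le> s * x + t)"
    if st: "(s, t) \<in> lines" "(s', t') \<in> lines" for s t s' t'
  proof (rule ccontr)
    assume "\<not> ?thesis"
    then obtain x y where x: "x \<in> {a..b}" "s' * x + t' < s * x + t"
      and y: "y \<in> {a..b}" "s * y + t < s' * y + t'"
      by (auto simp: not_le)
    have *: "a < - (t - t') / (s - s') \<and> - (t - t') / (s - s') < b"
      by (rule linear_root_between[OF _ _ x(1) y(1)]) (use x y in \<open>simp_all add: algebra_simps\<close>)
    then have "- (t - t') / (s - s') \<in> candidates"
      using assms(1,2) by (intro root_candidate[OF st]) linarith+
    then show False using no * by blast
  qed
  then show ?thesis unfolding uncrossed_def by fast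
qed

text \<open>Indices, capped values and running maxima all stay on lines of \<open>lines\<close>;
  only the sums over outcomes leave it. The induction over the boxes therefore lets the floor y vary
  with \<alpha> along a line.\<close>

lemma agent_value_affine:
  assumes "0 \<le> a" "b \<le> 1" and "\<And>x. x \<in> candidates \<Longrightarrow> \<not> (a < x \<and> x < b)"
  shows "affine_between a b agent_value"
proof -
  note un = uncrossed_lines[OF assms]
  have reward: "on_line lines a b (\<lambda>\<alpha>. \<alpha> * reward I j)" if "j \<in> outcomes I" for j
    unfolding on_line_def
    by (rule bexI[of _ "(reward I j, 0)"]) (use that in \<open>auto simp: lines_def\<close>)
  have line: "on_line lines a b (\<lambda>\<alpha>. index_line \<alpha> i l)" if "i \<in> actions I" "l \<in> outcomes I" for i l
    unfolding on_line_def index_line_eq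
    by (rule bexI[of _ "(line_slope i l, - line_icpt i l)"]) (use that in \<open>auto simp: lines_def\<close>)
  have index: "on_line lines a b (\<lambda>\<alpha>. index \<alpha> i)" if "i \<in> actions I" for i
    unfolding index_def
    by (rule on_line_Max[OF un]) (use that line index_lines_nonempty in auto)
  have capped: "on_line lines a b (\<lambda>\<alpha>. capped \<alpha> i j)" if "i \<in> actions I" "j \<in> outcomes I" for i j
    unfolding capped_def using that by (intro on_line_min[OF un] reward index)
  have "affine_between a b (\<lambda>\<alpha>. expected_max \<alpha> S (y \<alpha>))"
    if "finite S" "S \<subseteq> actions I" "on_line lines a b y" for S y
    using that
  proof (induction S arbitrary: y)
    case empty
    then show ?case by (simp add: expected_max_empty on_line_affine)
  next
    case (insert i S)
    have "affine_between a b (\<lambda>\<alpha>. expected_max \<alpha> S (max (y \<alpha>) (capped \<alpha> i j)))" if "j \<in> outcomes I" for j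
      using insert.prems that by (intro insert.IH on_line_max[OF un] capped) auto
    then show ?case
      using insert.hyps unfolding expected_max_insert[OF insert.hyps] open_box_def
      by (intro affine_between_sum) auto
  qed
  moreover have "on_line lines a b (\<lambda>_. 0)"
    using reward[OF one_in_outcomes] by (simp add: reward_one[simplified])
  ultimately show ?thesis
    using finite_actions by (auto simp: agent_value_def[abs_def])
qed

section \<open>Slopes of the agent value and the selected contract\<close>

definition chord_slope :: "real \<Rightarrow> real \<Rightarrow> real" where
  "chord_slope \<alpha> \<beta> = (agent_value \<beta> - agent_value \<alpha>) / (\<beta> - \<alpha>)"

text \<open>The right derivative of U at a candidate: U is convex and affine up to the next
  candidate or 1, so the least chord slope is the slope of that piece. Earlier candidates are not
  filtered out but given the chord to 1, so that a loop can run over all of them.\<close>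

definition right_slope :: "real \<Rightarrow> real" where
  "right_slope \<alpha> = Min (insert (chord_slope \<alpha> 1)
     ((\<lambda>\<beta>. if \<alpha> < \<beta> then chord_slope \<alpha> \<beta> else chord_slope \<alpha> 1) ` candidates))"

definition candidate_value :: "real \<Rightarrow> real" where
  "candidate_value \<alpha> = (1 - \<alpha>) * right_slope \<alpha>"

definition candidate_max :: real where
  "candidate_max = Max (insert (candidate_value 0) (candidate_value ` candidates))"

text \<open>Candidates of smaller value are masked by 0. That a result 0 is then itself of maximal
  value is part of \<open>optimum_candidate\<close>.\<close>

definition optimum :: real where
  "optimum = Max (insert 0 ((\<lambda>\<alpha>. if candidate_value \<alpha> < candidate_max then 0 else \<alpha>) ` candidates))"

section \<open>The principal's value under best responses\<close>

context
  fixes ord :: "strategy rel"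
  assumes ord: "linear_order_on (strategies I) ord"
begin

definition response :: "real \<Rightarrow> strategy" where
  "response \<alpha> = best_response I ord (linear_contract I \<alpha>)"

lemma response_tie_optimal: "response \<alpha> \<in> tie_optimal I (linear_contract I \<alpha>)"
  unfolding response_def by (rule best_response_tie_optimal[OF ord])

lemma response_strategies: "response \<alpha> \<in> strategies I"
  using response_tie_optimal[of \<alpha>]
  by (simp add: tie_optimal_def agent_optimal_def is_arg_max_def)

lemma response_optimal:
  assumes "0 \<le> \<alpha>"
  shows "\<alpha> * expected_reward (response \<alpha>) - expected_cost (response \<alpha>) = agent_value \<alpha>"
proof -
  have "\<not> agent_utility I (linear_contract I \<alpha>) (response \<alpha>) < agent_utility I (linear_contract I \<alpha>) (greedy \<alpha>)"
    using response_tie_optimal[of \<alpha>] greedy_strategies[of \<alpha>]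
    by (auto simp: tie_optimal_def agent_optimal_def is_arg_max_def)
  then show ?thesis
    using agent_utility_greedy[OF assms] agent_utility_le[OF assms response_strategies]
      agent_utility_linear[OF response_strategies, of \<alpha> \<alpha>] by (metis antisym_conv2)
qed

lemma utility_le:
  "0 \<le> \<alpha> \<Longrightarrow> \<pi> \<in> strategies I \<Longrightarrow> \<alpha> * expected_reward \<pi> - expected_cost \<pi> \<le> agent_value \<alpha>"
  using agent_utility_le agent_utility_linear by metis

text \<open>The principal's utility is 1 - \<alpha> > 0 times the expected reward, so tie-breaking
  favours larger expected reward.\<close>

lemma response_best_reward:
  assumes "0 \<le> \<alpha>" "\<alpha> < 1" "\<pi> \<in> strategies I"
    and "\<alpha> * expected_reward \<pi> - expected_cost \<pi> = agent_value \<alpha>"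
  shows "expected_reward \<pi> \<le> expected_reward (response \<alpha>)"
proof -
  have "\<pi> \<in> agent_optimal I (linear_contract I \<alpha>)"
    using assms(3,4) agent_utility_le[OF assms(1)]
    by (auto simp: agent_optimal_def is_arg_max_def agent_utility_linear not_less)
  then have "\<not> principal_utility I (linear_contract I \<alpha>) (response \<alpha>) < principal_utility I (linear_contract I \<alpha>) \<pi>"
    using response_tie_optimal[of \<alpha>] by (auto simp: tie_optimal_def is_arg_max_def)
  then show ?thesis using assms(2) by (simp add: principal_utility_linear)
qed

lemma principal_value_linear:
  "principal_value I ord (linear_contract I \<alpha>) = (1 - \<alpha>) * expected_reward (response \<alpha>)"
  by (simp add: principal_value_def principal_utility_linear response_def)

text \<open>The line of the response at \<alpha> meets U at \<alpha> and lies below it at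
  \<beta>.\<close>

lemma response_reward_le_chord:
  assumes "0 \<le> \<alpha>" "\<alpha> < \<beta>"
  shows "expected_reward (response \<alpha>) \<le> chord_slope \<alpha> \<beta>"
proof -
  have "(\<beta> - \<alpha>) * expected_reward (response \<alpha>) \<le> agent_value \<beta> - agent_value \<alpha>"
    using utility_le[OF _ response_strategies, of \<beta> \<alpha>] response_optimal[OF assms(1)] assms
    by (simp add: algebra_simps)
  then show ?thesis using assms(2) by (simp add: chord_slope_def le_divide_eq mult.commute)
qed

text \<open>The chord gives one bound. For the other, a strategy optimal at an interior point of the
  piece has a line that touches U there and hence coincides with it on the piece; it is thus optimal
  at \<alpha> with reward s, and tie-breaking yields at least s.\<close>

lemma affine_response:
  assumes "0 \<le> \<alpha>" "\<alpha> < \<beta>" "\<beta> \<le> 1" "\<And>x. x \<in> {\<alpha>..\<beta>} \<Longrightarrow> agent_value x = s * x + t"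
  shows "expected_reward (response \<alpha>) = s"
proof (rule antisym)
  have "chord_slope \<alpha> \<beta> = s"
    using assms by (simp add: chord_slope_def divide_eq_eq algebra_simps)
  then show "expected_reward (response \<alpha>) \<le> s"
    using response_reward_le_chord[OF assms(1,2)] by simp
  define \<gamma> where "\<gamma> = (\<alpha> + \<beta>) / 2"
  have \<gamma>: "\<alpha> < \<gamma>" "\<gamma> < \<beta>" "0 \<le> \<gamma>" using assms by (auto simp: \<gamma>_def)
  let ?R = "expected_reward (response \<gamma>)" and ?C = "expected_cost (response \<gamma>)"
  have 1: "\<gamma> * ?R - ?C = s * \<gamma> + t" using response_optimal[OF \<gamma>(3)] assms(4)[of \<gamma>] \<gamma> by simp
  have 2: "\<alpha> * ?R - ?C \<le> s * \<alpha> + t"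
    using utility_le[OF assms(1) response_strategies, of \<gamma>] assms(4)[of \<alpha>] assms(2) by simp
  have 3: "\<beta> * ?R - ?C \<le> s * \<beta> + t"
    using utility_le[OF _ response_strategies, of \<beta> \<gamma>] assms(4)[of \<beta>] assms(1,2) by simp
  \<comment> \<open>Touching at \<gamma> and lying below at both ends forces equal slopes.\<close>
  have "(\<gamma> - \<alpha>) * (s - ?R) \<le> 0" "(\<beta> - \<gamma>) * (?R - s) \<le> 0"
    using 1 2 3 by (simp_all add: algebra_simps)
  then have R: "?R = s" using \<gamma> by (simp add: mult_le_0_iff)
  then have "\<alpha> * ?R - ?C = agent_value \<alpha>" using 1 assms(2) assms(4)[of \<alpha>] by simp
  from response_best_reward[OF assms(1) _ response_strategies this]
  show "s \<le> expected_reward (response \<alpha>)" using R assms(2,3) by simp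
qed

lemma next_candidate:
  assumes "0 \<le> \<alpha>" "\<alpha> < 1"
  obtains \<beta> where "\<beta> \<in> insert 1 candidates" "\<alpha> < \<beta>" "\<beta> \<le> 1"
    "\<And>x. x \<in> candidates \<Longrightarrow> \<alpha> < x \<Longrightarrow> \<beta> \<le> x"
proof -
  let ?S = "{x\<in>insert 1 candidates. \<alpha> < x}"
  have fin: "finite ?S" by simp
  have "Min ?S \<in> ?S" using assms by (intro Min_in fin) auto
  moreover have "Min ?S \<le> x" if "x \<in> ?S" for x using that by (rule Min_le[OF fin])
  ultimately show ?thesis using that[of "Min ?S"] assms(2) by auto
qed

text \<open>The reward is at most every chord slope, and the chord to the next candidate has slope
  equal to the reward, so it is the minimum.\<close>

lemma response_reward_candidate:
  assumes "\<alpha> \<in> insert 0 candidates"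
  shows "expected_reward (response \<alpha>) = right_slope \<alpha>"
proof -
  have \<alpha>: "0 \<le> \<alpha>" "\<alpha> < 1" using assms candidates_bounds by auto
  obtain \<beta> where \<beta>: "\<beta> \<in> insert 1 candidates" "\<alpha> < \<beta>" "\<beta> \<le> 1"
    "\<And>x. x \<in> candidates \<Longrightarrow> \<alpha> < x \<Longrightarrow> \<beta> \<le> x"
    using next_candidate[OF \<alpha>] by blast
  have "affine_between \<alpha> \<beta> agent_value"
    using \<alpha> \<beta>(3,4) by (intro agent_value_affine) force+
  then obtain s t where st: "\<And>x. x \<in> {\<alpha>..\<beta>} \<Longrightarrow> agent_value x = s * x + t"
    by (auto simp: affine_between_def)
  have R: "expected_reward (response \<alpha>) = s"
    by (rule affine_response[OF \<alpha>(1) \<beta>(2,3) st])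
  have "chord_slope \<alpha> \<beta> = s"
    using \<beta>(2) st[of \<alpha>] st[of \<beta>] by (simp add: chord_slope_def divide_eq_eq algebra_simps)
  moreover have "right_slope \<alpha> \<le> chord_slope \<alpha> \<beta>"
    unfolding right_slope_def using \<beta>(1,2) by (intro Min_le) auto
  moreover have "expected_reward (response \<alpha>) \<le> right_slope \<alpha>"
    unfolding right_slope_def using response_reward_le_chord[OF \<alpha>(1)] \<alpha>(2) by (subst Min_ge_iff) auto
  ultimately show ?thesis using R by simp
qed

lemma principal_value_candidate:
  "\<alpha> \<in> insert 0 candidates \<Longrightarrow> principal_value I ord (linear_contract I \<alpha>) = candidate_value \<alpha>"
  by (simp only: principal_value_linear response_reward_candidate candidate_value_def)

text \<open>Moving left to the start of the piece keeps the expected reward from falling and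
  enlarges the factor 1 - \<alpha>.\<close>

lemma principal_value_le_candidate:
  assumes "\<alpha> \<in> {0..1}"
  obtains \<alpha>' where "\<alpha>' \<in> insert 0 candidates"
    "principal_value I ord (linear_contract I \<alpha>) \<le> principal_value I ord (linear_contract I \<alpha>')"
proof (cases "\<alpha> = 1")
  case True
  have "0 \<le> expected_reward (response 0)" by (rule expected_reward_nonneg[OF response_strategies])
  then show ?thesis using that[of 0] True by (simp add: principal_value_linear)
next
  case False
  let ?S = "{x\<in>insert 0 candidates. x \<le> \<alpha>}"
  define \<alpha>' where "\<alpha>' = Max ?S"
  have fin: "finite ?S" by simp
  have mem: "\<alpha>' \<in> ?S" unfolding \<alpha>'_def using assms by (intro Max_in fin) auto
  have max: "x \<le> \<alpha>'" if "x \<in> ?S" for x unfolding \<alpha>'_def using that by (rule Max_ge[OF fin])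
  have bounds: "0 \<le> \<alpha>'" "\<alpha>' < 1" using mem candidates_bounds by auto
  obtain \<beta> where \<beta>: "\<beta> \<in> insert 1 candidates" "\<alpha>' < \<beta>" "\<beta> \<le> 1"
    "\<And>x. x \<in> candidates \<Longrightarrow> \<alpha>' < x \<Longrightarrow> \<beta> \<le> x"
    using next_candidate[OF bounds] by blast
  \<comment> \<open>Otherwise \<beta> would be an element of \<open>?S\<close> above its maximum;
    \<beta> = 1 is handled by \<alpha> \<noteq> 1.\<close>
  have "\<alpha> < \<beta>" using max[of \<beta>] \<beta>(1,2) assms False by force
  have "affine_between \<alpha>' \<beta> agent_value"
    using bounds \<beta>(3,4) by (intro agent_value_affine) force+
  then obtain s t where st: "\<And>x. x \<in> {\<alpha>'..\<beta>} \<Longrightarrow> agent_value x = s * x + t"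
    by (auto simp: affine_between_def)
  have R: "expected_reward (response \<alpha>') = s"
    by (rule affine_response[OF bounds(1) \<beta>(2,3) st])
  have "chord_slope \<alpha> \<beta> = s"
    using \<open>\<alpha> < \<beta>\<close> st[of \<alpha>] st[of \<beta>] mem by (simp add: chord_slope_def divide_eq_eq algebra_simps)
  then have "expected_reward (response \<alpha>) \<le> s"
    using response_reward_le_chord[of \<alpha> \<beta>] \<open>\<alpha> < \<beta>\<close> assms by simp
  then have "(1 - \<alpha>) * expected_reward (response \<alpha>) \<le> (1 - \<alpha>) * s"
    using assms by (intro mult_left_mono) auto
  also have "\<dots> \<le> (1 - \<alpha>') * s"
    using expected_reward_nonneg[OF response_strategies, of \<alpha>'] R mem by (intro mult_right_mono) auto
  finally show ?thesis using that[of \<alpha>'] mem R by (simp add: principal_value_linear)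
qed

text \<open>The critical case is the result 0: a maximizing z is not masked, so z \<le> 0 and hence
  z = 0.\<close>

lemma optimum_candidate: "optimum \<in> insert 0 candidates \<and> candidate_value optimum = candidate_max"
proof -
  let ?A = "insert 0 ((\<lambda>\<alpha>. if candidate_value \<alpha> < candidate_max then 0 else \<alpha>) ` candidates)"
  have le: "candidate_value z \<le> candidate_max" if "z \<in> insert 0 candidates" for z
    unfolding candidate_max_def using that by (intro Max_ge) auto
  have opt: "optimum \<in> ?A" unfolding optimum_def by (rule Max_in) auto
  then have mem: "optimum \<in> insert 0 candidates" by (auto split: if_splits)
  show ?thesis
  proof (cases "optimum = 0")
    case False
    then have "\<not> candidate_value optimum < candidate_max" using opt by (auto split: if_splits)
    then show ?thesis using le[OF mem] mem by simp
  next
    case True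
    have "candidate_max \<in> insert (candidate_value 0) (candidate_value ` candidates)"
      unfolding candidate_max_def by (rule Max_in) auto
    then obtain z where z: "z \<in> insert 0 candidates" "candidate_max = candidate_value z" by auto
    have "z \<le> optimum"
    proof (cases "z = 0")
      case False
      then show ?thesis unfolding optimum_def using z by (intro Max_ge) (auto intro!: image_eqI[of _ _ z])
    qed (use True in simp)
    then have "z = 0" using True z(1) candidates_bounds by force
    then show ?thesis using True z(2) by simp
  qed
qed

lemma optimal_linear_optimum: "optimal_linear I ord optimum"
  unfolding optimal_linear_def is_arg_max_def
proof (intro conjI notI)
  note opt = optimum_candidate
  show "optimum \<in> {0..1}" using opt candidates_bounds by force
  assume "\<exists>y. y \<in> {0..1} \<and> principal_value I ord (linear_contract I optimum) < principal_value I ord (linear_contract I y)"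
  then obtain y where y: "y \<in> {0..1}"
    "principal_value I ord (linear_contract I optimum) < principal_value I ord (linear_contract I y)" by blast
  obtain z where z: "z \<in> insert 0 candidates"
    "principal_value I ord (linear_contract I y) \<le> principal_value I ord (linear_contract I z)"
    using principal_value_le_candidate[OF y(1)] .
  have "candidate_value z \<le> candidate_max"
    unfolding candidate_max_def using z(1) by (intro Max_ge) auto
  then show False
    using y(2) z(2) principal_value_candidate[OF z(1)] principal_value_candidate[of optimum] opt by simp
qed

end

end


section \<open>Evaluating the optimum\<close>

context contract_instance begin

section \<open>A closed formula of polynomial size for the agent value\<close>

definition cdf_le :: "real \<Rightarrow> nat \<Rightarrow> real \<Rightarrow> real" where
  "cdf_le \<alpha> k y = (\<Sum>j\<in>outcomes I. if y < capped \<alpha> k j then 0 else outcome_prob I k j)"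

definition cdf_less :: "real \<Rightarrow> nat \<Rightarrow> real \<Rightarrow> real" where
  "cdf_less \<alpha> k y = (\<Sum>j\<in>outcomes I. if capped \<alpha> k j < y then outcome_prob I k j else 0)"

text \<open>Ties are broken in favour of the last box, hence the strict inequality for \<open>k > i\<close>.\<close>

definition argmax_prob :: "real \<Rightarrow> nat \<Rightarrow> nat \<Rightarrow> real \<Rightarrow> real" where
  "argmax_prob \<alpha> n i y =
     (\<Prod>k\<in>{1..n}. if k < i then cdf_le \<alpha> k y else if i < k then cdf_less \<alpha> k y else 1)"

text \<open>Either y remains the maximum, or the maximum is attained last at a box i with outcome j.
  This turns n nested expectations into polynomially many terms. Box n + 1 is added with each step
  of the induction.\<close>

lemma expected_max_formula:
  "expected_max \<alpha> {1..n} y = y * (\<Prod>k\<in>{1..n}. cdf_le \<alpha> k y) +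
     (\<Sum>i\<in>{1..n}. \<Sum>j\<in>outcomes I. if y < capped \<alpha> i j
        then outcome_prob I i j * capped \<alpha> i j * argmax_prob \<alpha> n i (capped \<alpha> i j) else 0)"
proof (induction n arbitrary: y)
  case 0
  then show ?case by (simp add: expected_max_empty)
next
  case (Suc n)
  let ?p = "outcome_prob I (Suc n)" and ?v = "capped \<alpha> (Suc n)"
  let ?G = "\<lambda>z. \<Prod>k\<in>{1..n}. cdf_le \<alpha> k z"
  let ?w = "\<lambda>i j. outcome_prob I i j * capped \<alpha> i j * argmax_prob \<alpha> n i (capped \<alpha> i j)"
  have "expected_max \<alpha> {1..Suc n} y = open_box \<alpha> (Suc n) (expected_max \<alpha> {1..n}) y"
    by (simp add: atLeastAtMostSuc_conv expected_max_insert)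
  also have "\<dots> = (\<Sum>l\<in>outcomes I. ?p l * (max y (?v l) * ?G (max y (?v l)))) +
      (\<Sum>l\<in>outcomes I. \<Sum>i\<in>{1..n}. \<Sum>j\<in>outcomes I. ?p l * (if max y (?v l) < capped \<alpha> i j then ?w i j else 0))"
    by (simp only: open_box_def Suc.IH distrib_left sum.distrib sum_distrib_left)
  \<comment> \<open>The floor stays y unless the capped value of box n + 1 exceeds it.\<close>
  also have "(\<Sum>l\<in>outcomes I. ?p l * (max y (?v l) * ?G (max y (?v l)))) =
      (\<Sum>l\<in>outcomes I. (if y < ?v l then 0 else ?p l) * (y * ?G y) +
         (if y < ?v l then ?p l * ?v l * ?G (?v l) else 0))"
    by (intro sum.cong) (auto simp: max_def)
  also have "\<dots> = y * (?G y * cdf_le \<alpha> (Suc n) y) +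
      (\<Sum>l\<in>outcomes I. if y < ?v l then ?p l * ?v l * ?G (?v l) else 0)"
    by (simp add: sum.distrib cdf_le_def sum_distrib_left sum_distrib_right mult_ac)
  also have "(\<Sum>l\<in>outcomes I. \<Sum>i\<in>{1..n}. \<Sum>j\<in>outcomes I. ?p l * (if max y (?v l) < capped \<alpha> i j then ?w i j else 0)) =
      (\<Sum>i\<in>{1..n}. \<Sum>l\<in>outcomes I. \<Sum>j\<in>outcomes I. ?p l * (if max y (?v l) < capped \<alpha> i j then ?w i j else 0))"
    by (rule sum.swap)
  also have "\<dots> =
      (\<Sum>i\<in>{1..n}. \<Sum>j\<in>outcomes I. \<Sum>l\<in>outcomes I. ?p l * (if max y (?v l) < capped \<alpha> i j then ?w i j else 0))"
    by (intro sum.cong refl sum.swap)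
  \<comment> \<open>An earlier box wins only by strictly beating box n + 1, which contributes a
    factor \<open>cdf_less\<close>.\<close>
  also have "\<dots> = (\<Sum>i\<in>{1..n}. \<Sum>j\<in>outcomes I. if y < capped \<alpha> i j
        then outcome_prob I i j * capped \<alpha> i j * argmax_prob \<alpha> (Suc n) i (capped \<alpha> i j) else 0)"
  proof (intro sum.cong refl)
    fix i j assume i: "i \<in> {1..n}"
    have "(\<Sum>l\<in>outcomes I. ?p l * (if max y (?v l) < capped \<alpha> i j then ?w i j else 0)) =
        (\<Sum>l\<in>outcomes I. (if y < capped \<alpha> i j then ?w i j else 0) * (if ?v l < capped \<alpha> i j then ?p l else 0))"
      by (intro sum.cong) auto
    also have "\<dots> = (if y < capped \<alpha> i j then ?w i j else 0) * cdf_less \<alpha> (Suc n) (capped \<alpha> i j)"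
      by (simp add: cdf_less_def sum_distrib_left)
    also have "\<dots> = (if y < capped \<alpha> i j
        then outcome_prob I i j * capped \<alpha> i j * argmax_prob \<alpha> (Suc n) i (capped \<alpha> i j) else 0)"
      using i by (simp add: argmax_prob_def)
    finally show "(\<Sum>l\<in>outcomes I. ?p l * (if max y (?v l) < capped \<alpha> i j then ?w i j else 0)) = \<dots>" .
  qed
  \<comment> \<open>When box n + 1 wins, all others need only be weakly smaller.\<close>
  also have "(\<Sum>l\<in>outcomes I. if y < ?v l then ?p l * ?v l * ?G (?v l) else 0) =
      (\<Sum>l\<in>outcomes I. if y < ?v l then ?p l * ?v l * argmax_prob \<alpha> (Suc n) (Suc n) (?v l) else 0)"
  proof -
    have "argmax_prob \<alpha> (Suc n) (Suc n) z = ?G z" for z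
      by (simp add: argmax_prob_def)
    then show ?thesis by (simp only:)
  qed
  finally show ?case by simp
qed

lemma agent_value_formula:
  "agent_value \<alpha> = (\<Sum>i\<in>actions I. \<Sum>j\<in>outcomes I. if 0 < capped \<alpha> i j
     then outcome_prob I i j * capped \<alpha> i j * argmax_prob \<alpha> (num_actions I) i (capped \<alpha> i j) else 0)"
  using expected_max_formula[of \<alpha> "num_actions I" 0] by (simp add: agent_value_def actions_def)

end

section \<open>Maxima and minima as loops\<close>

definition extremum :: "aop \<Rightarrow> real set \<Rightarrow> real" where
  "extremum f S = (if f = AMax then Max S else Min S)"

lemma extremum_Un:
  assumes "f \<in> {AMax, AMin}" "finite S" "S \<noteq> {}" "finite T" "T \<noteq> {}"
  shows "extremum f (S \<union> T) = aop_val f (extremum f S) (extremum f T)"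
  using assms by (auto simp: extremum_def Max_Un Min_Un)

lemma extremum_singleton: "extremum f {x} = x"
  by (simp add: extremum_def)

text \<open>Nested loops all starting from the same \<open>a\<close> flatten to one extremum over
  the union, since further copies of \<open>a\<close> change nothing.\<close>

lemma extremum_UN:
  assumes f: "f \<in> {AMax, AMin}" and "finite A"
    and "\<And>i. i \<in> A \<Longrightarrow> finite (S i) \<and> h i = extremum f (insert a (S i))"
  shows "extremum f (insert a (h ` A)) = extremum f (insert a (\<Union>i\<in>A. S i))"
  using assms(2,3)
proof (induction A rule: finite_induct)
  case empty
  then show ?case by simp
next
  case (insert i A)
  have "extremum f (insert a (h ` insert i A)) = aop_val f (h i) (extremum f (insert a (h ` A)))"
    using extremum_Un[OF f, of "{h i}" "insert a (h ` A)"] insert.hyps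
    by (simp add: extremum_singleton insert_commute)
  also have "\<dots> = aop_val f (extremum f (insert a (S i))) (extremum f (insert a (\<Union>i\<in>A. S i)))"
    using insert by simp
  also have "\<dots> = extremum f (insert a (S i) \<union> insert a (\<Union>i\<in>A. S i))"
    using insert by (intro extremum_Un[OF f, symmetric]) auto
  finally show ?case by (simp add: insert_commute)
qed

lemma fold_extremum:
  assumes "f \<in> {AMax, AMin}"
  shows "fold (\<lambda>i y. aop_val f y (g i)) [1..<Suc N] a = extremum f (insert a (g ` {1..N}))"
proof (induction N)
  case 0
  then show ?case by (simp add: extremum_singleton)
next
  case (Suc N)
  have "fold (\<lambda>i y. aop_val f y (g i)) [1..<Suc (Suc N)] a =
      aop_val f (extremum f (insert a (g ` {1..N}))) (extremum f {g (Suc N)})"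
    using Suc by (simp add: extremum_singleton)
  also have "\<dots> = extremum f (insert a (g ` {1..N}) \<union> {g (Suc N)})"
    by (rule extremum_Un[OF assms, symmetric]) auto
  finally show ?case by (simp add: atLeastAtMostSuc_conv insert_commute)
qed

lemma fold_add: "fold (\<lambda>i y. y + g i) [1..<Suc N] a = a + (\<Sum>i = 1..N. g i)" for a :: real
  by (induction N) (simp_all add: add.assoc)

lemma fold_mult: "fold (\<lambda>i y. y * g i) [1..<Suc N] a = a * (\<Prod>i = 1..N. g i)" for a :: real
  by (induction N) (simp_all add: mult.assoc)

text \<open>
  Variable capture is avoided by numbering: an expression binds only variables with smaller numbers
  than those of its parameters.
\<close>

definition x_tail_prob :: "nat \<Rightarrow> nat \<Rightarrow> fx" where
  "x_tail_prob i l = XRed AAdd False 0 (XLit 0) (XNLess 0 l (XLit 0) (XProb i 0))"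

definition x_tail_reward :: "nat \<Rightarrow> nat \<Rightarrow> fx" where
  "x_tail_reward i l = XRed AAdd False 0 (XLit 0) (XNLess 0 l (XLit 0) (XBin AMul (XProb i 0) (XRew 0)))"

text \<open>The cost with negative sign serves as start value and replaces lines of null tails. It
  never exceeds the index: the line for l = 1 is the nonnegative expected payment minus the
  cost.\<close>

definition x_index :: "nat \<Rightarrow> nat \<Rightarrow> fx" where
  "x_index i a = XRed AMax False 1 (XBin ASub (XLit 0) (XCost i))
     (XLess (XLit 0) (x_tail_prob i 1)
       (XBin ADiv (XBin ASub (XBin AMul (XVar a) (x_tail_reward i 1)) (XCost i)) (x_tail_prob i 1))
       (XBin ASub (XLit 0) (XCost i)))"

definition x_capped :: "nat \<Rightarrow> nat \<Rightarrow> nat \<Rightarrow> fx" where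
  "x_capped i j a = XBin AMin (XBin AMul (XVar a) (XRew j)) (x_index i a)"

definition x_cdf_le :: "nat \<Rightarrow> nat \<Rightarrow> nat \<Rightarrow> fx" where
  "x_cdf_le k y a = XRed AAdd False 2 (XLit 0) (XLess (XVar y) (x_capped k 2 a) (XLit 0) (XProb k 2))"

definition x_cdf_less :: "nat \<Rightarrow> nat \<Rightarrow> nat \<Rightarrow> fx" where
  "x_cdf_less k y a = XRed AAdd False 2 (XLit 0) (XLess (x_capped k 2 a) (XVar y) (XProb k 2) (XLit 0))"

definition x_value :: "nat \<Rightarrow> fx" where
  "x_value a = XRed AAdd True 3 (XLit 0) (XRed AAdd False 4 (XLit 0) (XLet 0 (x_capped 3 4 a)
     (XLess (XLit 0) (XVar 0)
       (XBin AMul (XBin AMul (XProb 3 4) (XVar 0))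
         (XRed AMul True 5 (XLit 1)
           (XNLess 5 3 (x_cdf_le 5 0 a) (XNLess 3 5 (x_cdf_less 5 0 a) (XLit 1)))))
       (XLit 0))))"

definition x_chord :: "nat \<Rightarrow> nat \<Rightarrow> fx" where
  "x_chord a b = XBin ADiv (XBin ASub (x_value b) (x_value a)) (XBin ASub (XVar b) (XVar a))"

definition x_line_slope :: "nat \<Rightarrow> nat \<Rightarrow> fx" where
  "x_line_slope i l = XBin ADiv (x_tail_reward i l) (x_tail_prob i l)"

definition x_line_icpt :: "nat \<Rightarrow> nat \<Rightarrow> fx" where
  "x_line_icpt i l = XBin ADiv (XCost i) (x_tail_prob i l)"

definition x_clip :: "fx \<Rightarrow> fx" where
  "x_clip e = XLet 1 e (XLess (XLit 0) (XVar 1) (XLess (XVar 1) (XLit 1) (XVar 1) (XLit 0)) (XLit 0))"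

text \<open>The start value \<open>e0\<close> recurs at every level, even in the innermost
  expression, to meet the form required by \<open>extremum_UN\<close>.\<close>

definition x_candidates :: "aop \<Rightarrow> nat \<Rightarrow> fx \<Rightarrow> fx \<Rightarrow> fx" where
  "x_candidates f x e0 e =
     XRed f True 6 e0 (XRed f False 7 e0 (XRed f True 8 e0 (XRed f False 9 e0 (XBin f e0 (XBin f
       (XLet x (x_clip (XBin ADiv (XBin ASub (x_line_icpt 6 7) (x_line_icpt 8 9))
          (XBin ASub (x_line_slope 6 7) (x_line_slope 8 9)))) e)
       (XLet x (x_clip (XBin ADiv (x_line_icpt 6 7) (XBin ASub (x_line_slope 6 7) (XRew 9)))) e))))))"

definition x_right_slope :: fx where
  "x_right_slope = x_candidates AMin 3 (XLet 3 (XLit 1) (x_chord 2 3))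
     (XLess (XVar 2) (XVar 3) (x_chord 2 3) (XLet 3 (XLit 1) (x_chord 2 3)))"

definition x_candidate_value :: fx where
  "x_candidate_value = XBin AMul (XBin ASub (XLit 1) (XVar 2)) x_right_slope"

text \<open>Real variable 2 holds \<alpha>, 3 the later point \<beta>, and 4 the maximal value,
  found in a first pass over the candidates.\<close>

definition x_optimum :: fx where
  "x_optimum = XLet 4 (x_candidates AMax 2 (XLet 2 (XLit 0) x_candidate_value) x_candidate_value)
     (x_candidates AMax 2 (XLit 0) (XLess x_candidate_value (XVar 4) (XLit 0) (XVar 2)))"

section \<open>Values of the formulas on the input\<close>

context contract_instance begin

abbreviation ev :: "fx \<Rightarrow> (nat \<Rightarrow> nat) \<Rightarrow> (nat \<Rightarrow> real) \<Rightarrow> real" where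
  "ev \<equiv> fval (input_state I)"

lemma bound_input: "nats (input_state I) (bound_name b) = (if b then num_actions I else num_outcomes I)"
  by (simp add: input_state_def bound_name_def)

lemma ev_sum:
  "ev (XRed AAdd b v (XLit 0) e) \<rho> \<theta> =
    (\<Sum>i\<in>(if b then actions I else outcomes I). ev e (\<rho>(v := i)) \<theta>)"
  using fold_add[of "\<lambda>i. ev e (\<rho>(v := i)) \<theta>" "if b then num_actions I else num_outcomes I" 0]
  by (simp only: fval.simps aop_val.simps bound_input actions_def outcomes_def) simp

lemma ev_prod:
  "ev (XRed AMul b v (XLit 1) e) \<rho> \<theta> =
    (\<Prod>i\<in>(if b then actions I else outcomes I). ev e (\<rho>(v := i)) \<theta>)"
  using fold_mult[of "\<lambda>i. ev e (\<rho>(v := i)) \<theta>" "if b then num_actions I else num_outcomes I" 1]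
  by (simp only: fval.simps aop_val.simps bound_input actions_def outcomes_def) simp

lemma ev_extremum:
  assumes "f \<in> {AMax, AMin}"
  shows "ev (XRed f b v e0 e) \<rho> \<theta> =
    extremum f (insert (ev e0 \<rho> \<theta>) ((\<lambda>i. ev e (\<rho>(v := i)) \<theta>) ` (if b then actions I else outcomes I)))"
  using fold_extremum[OF assms, of "\<lambda>i. ev e (\<rho>(v := i)) \<theta>" "if b then num_actions I else num_outcomes I"]
  by (simp only: fval.simps bound_input actions_def outcomes_def) simp

lemma ev_reduce:
  assumes f: "f \<in> {AMax, AMin}" and e0: "ev e0 \<rho> \<theta> = a"
  shows "(\<And>i. i \<in> actions I \<Longrightarrow> ev e (\<rho>(v := i)) \<theta> = extremum f (insert a (S i))) \<Longrightarrow>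
      (\<And>i. i \<in> actions I \<Longrightarrow> finite (S i)) \<Longrightarrow>
      ev (XRed f True v e0 e) \<rho> \<theta> = extremum f (insert a (\<Union>i\<in>actions I. S i))"
    and "(\<And>j. j \<in> outcomes I \<Longrightarrow> ev e (\<rho>(v := j)) \<theta> = extremum f (insert a (S j))) \<Longrightarrow>
      (\<And>j. j \<in> outcomes I \<Longrightarrow> finite (S j)) \<Longrightarrow>
      ev (XRed f False v e0 e) \<rho> \<theta> = extremum f (insert a (\<Union>j\<in>outcomes I. S j))"
  unfolding ev_extremum[OF f] e0 if_True if_False
  by (rule extremum_UN[OF f]; simp)+

lemma ev_input [simp]:
  "\<rho> i \<in> actions I \<Longrightarrow> ev (XCost i) \<rho> \<theta> = cost I (\<rho> i)"
  "\<rho> j \<in> outcomes I \<Longrightarrow> ev (XRew j) \<rho> \<theta> = reward I (\<rho> j)"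
  "\<rho> i \<in> actions I \<Longrightarrow> \<rho> j \<in> outcomes I \<Longrightarrow> ev (XProb i j) \<rho> \<theta> = outcome_prob I (\<rho> i) (\<rho> j)"
  by (simp_all add: input_state_def)

lemma ev_tail_prob:
  assumes "i \<noteq> 0" "l \<noteq> 0" "\<rho> i \<in> actions I"
  shows "ev (x_tail_prob i l) \<rho> \<theta> = tail_prob (\<rho> i) (\<rho> l)"
  unfolding x_tail_prob_def tail_prob_def sum.inter_filter[OF finite_outcomes] ev_sum
  using assms by (auto intro!: sum.cong simp del: fval.simps(3-5) fval.simps(10))

lemma ev_tail_reward:
  assumes "i \<noteq> 0" "l \<noteq> 0" "\<rho> i \<in> actions I"
  shows "ev (x_tail_reward i l) \<rho> \<theta> = tail_reward (\<rho> i) (\<rho> l)"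
  unfolding x_tail_reward_def tail_reward_def sum.inter_filter[OF finite_outcomes] ev_sum
  using assms by (auto intro!: sum.cong simp del: fval.simps(3-5) fval.simps(10))

lemma ev_index:
  assumes "i \<notin> {0, 1}" "\<rho> i \<in> actions I" "0 \<le> \<theta> a"
  shows "ev (x_index i a) \<rho> \<theta> = index (\<theta> a) (\<rho> i)"
proof -
  let ?c = "- cost I (\<rho> i)"
  let ?g = "\<lambda>l. if 0 < tail_prob (\<rho> i) l then index_line (\<theta> a) (\<rho> i) l else ?c"
  have "ev (x_index i a) \<rho> \<theta> = Max (insert ?c (?g ` outcomes I))"
    using assms unfolding x_index_def
    by (subst ev_extremum)
       (auto simp: extremum_def ev_tail_prob ev_tail_reward index_line_def
             simp del: fval.simps(3-5) fval.simps(10))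
  also have "\<dots> = index (\<theta> a) (\<rho> i)"
  proof (rule Max_eqI)
    have "?c \<le> \<theta> a * tail_reward (\<rho> i) 1 - cost I (\<rho> i)"
      using assms(3) tail_reward_nonneg by simp
    also have "\<dots> = index_line (\<theta> a) (\<rho> i) 1"
      using tail_prob_one[OF assms(2)] by (simp add: index_line_def)
    also have "\<dots> \<le> index (\<theta> a) (\<rho> i)"
      using tail_prob_one[OF assms(2)] by (intro index_line_le_index one_in_outcomes) simp
    finally have c: "?c \<le> index (\<theta> a) (\<rho> i)" .
    fix y assume "y \<in> insert ?c (?g ` outcomes I)"
    then show "y \<le> index (\<theta> a) (\<rho> i)" using c index_line_le_index by auto
  next
    show "index (\<theta> a) (\<rho> i) \<in> insert ?c (?g ` outcomes I)"
    proof -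
      obtain l where "l \<in> outcomes I" "0 < tail_prob (\<rho> i) l"
        "index (\<theta> a) (\<rho> i) = index_line (\<theta> a) (\<rho> i) l"
        using index_attained[OF assms(2)] .
      then show ?thesis by (intro insertI2 image_eqI[of _ _ l]) simp_all
    qed
  qed simp
  finally show ?thesis .
qed

lemma ev_capped:
  assumes "i \<notin> {0, 1}" "\<rho> i \<in> actions I" "\<rho> j \<in> outcomes I" "0 \<le> \<theta> a"
  shows "ev (x_capped i j a) \<rho> \<theta> = capped (\<theta> a) (\<rho> i) (\<rho> j)"
  using assms by (simp add: x_capped_def capped_def ev_index del: fval.simps(3-5) fval.simps(10))

lemma ev_cdf:
  assumes "k \<notin> {0, 1, 2}" "\<rho> k \<in> actions I" "0 \<le> \<theta> a"
  shows "ev (x_cdf_le k y a) \<rho> \<theta> = cdf_le (\<theta> a) (\<rho> k) (\<theta> y)"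
    and "ev (x_cdf_less k y a) \<rho> \<theta> = cdf_less (\<theta> a) (\<rho> k) (\<theta> y)"
  unfolding x_cdf_le_def cdf_le_def x_cdf_less_def cdf_less_def ev_sum
  using assms by (auto intro!: sum.cong simp: ev_capped simp del: fval.simps(3-5) fval.simps(10))

lemma ev_value:
  assumes "a \<noteq> 0" "0 \<le> \<theta> a"
  shows "ev (x_value a) \<rho> \<theta> = agent_value (\<theta> a)"
proof -
  have prod: "ev (XRed AMul True 5 (XLit 1)
           (XNLess 5 3 (x_cdf_le 5 0 a) (XNLess 3 5 (x_cdf_less 5 0 a) (XLit 1)))) \<rho>' \<theta>' =
      argmax_prob (\<theta> a) (num_actions I) (\<rho>' 3) (\<theta>' 0)" if "\<theta>' a = \<theta> a" for \<rho>' \<theta>'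
    unfolding ev_prod argmax_prob_def
    using assms that
    by (auto intro!: prod.cong simp: ev_cdf actions_def simp del: fval.simps(3-5) fval.simps(10))
  show ?thesis
    unfolding x_value_def agent_value_formula ev_sum
    using assms
    by (auto intro!: sum.cong simp: ev_capped prod simp del: fval.simps(3-5) fval.simps(10))
qed

lemma ev_chord:
  assumes "a \<noteq> 0" "0 \<le> \<theta> a" "b \<noteq> 0" "0 \<le> \<theta> b"
  shows "ev (x_chord a b) \<rho> \<theta> = chord_slope (\<theta> a) (\<theta> b)"
  using assms by (simp add: x_chord_def chord_slope_def ev_value)

lemma ev_line:
  assumes "i \<noteq> 0" "l \<noteq> 0" "\<rho> i \<in> actions I"
  shows "ev (x_line_slope i l) \<rho> \<theta> = line_slope (\<rho> i) (\<rho> l)"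
    and "ev (x_line_icpt i l) \<rho> \<theta> = line_icpt (\<rho> i) (\<rho> l)"
  using assms
  by (simp_all add: x_line_slope_def line_slope_def x_line_icpt_def line_icpt_def ev_tail_prob ev_tail_reward
      del: fval.simps(3-5) fval.simps(10))

lemma ev_clip: "ev (x_clip e) \<rho> \<theta> = clip (ev e \<rho> \<theta>)"
  by (simp add: x_clip_def clip_def)

text \<open>Each of the four loops contributes one union in \<open>candidates\<close>. The body
  \<open>e\<close> need be correct only at candidates, where nonnegativity is available.\<close>

lemma ev_candidates:
  assumes f: "f \<in> {AMax, AMin}" and e0: "\<And>\<rho>. ev e0 \<rho> \<theta> = a"
    and e: "\<And>\<rho> z. z \<in> candidates \<Longrightarrow> ev e \<rho> (\<theta>(x := z)) = g z"
  shows "ev (x_candidates f x e0 e) \<rho> \<theta> = extremum f (insert a (g ` candidates))"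
proof -
  let ?C = "\<lambda>i l i' l'. {clip (crossing i l i' l'), clip (reward_crossing i l l')}"
  have inner: "ev (XBin f e0 (XBin f
       (XLet x (x_clip (XBin ADiv (XBin ASub (x_line_icpt 6 7) (x_line_icpt 8 9))
          (XBin ASub (x_line_slope 6 7) (x_line_slope 8 9)))) e)
       (XLet x (x_clip (XBin ADiv (x_line_icpt 6 7) (XBin ASub (x_line_slope 6 7) (XRew 9)))) e)))
       (\<rho>(6 := i, 7 := l, 8 := i', 9 := l')) \<theta> = extremum f (insert a (g ` ?C i l i' l'))"
    if "i \<in> actions I" "l \<in> outcomes I" "i' \<in> actions I" "l' \<in> outcomes I" for i l i' l'
  proof -
    have cand: "clip (crossing i l i' l') \<in> candidates" "clip (reward_crossing i l l') \<in> candidates"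
      unfolding candidates_def using that by blast+
    have "extremum f (insert a (g ` ?C i l i' l')) = aop_val f a
        (aop_val f (g (clip (crossing i l i' l'))) (g (clip (reward_crossing i l l'))))"
      using extremum_Un[OF f, of "{a}" "g ` ?C i l i' l'"]
        extremum_Un[OF f, of "{g (clip (crossing i l i' l'))}" "{g (clip (reward_crossing i l l'))}"]
      by (simp add: extremum_singleton insert_commute)
    then show ?thesis
      using that cand e
      by (simp add: e0 ev_clip ev_line crossing_def reward_crossing_def del: fval.simps(3-5) fval.simps(10))
  qed
  show ?thesis
    unfolding x_candidates_def candidates_def image_UN
    by (rule ev_reduce(1)[OF f e0], rule ev_reduce(2)[OF f e0],
        rule ev_reduce(1)[OF f e0], rule ev_reduce(2)[OF f e0], rule inner) simp_all
qed

lemma ev_right_slope: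
  assumes "0 \<le> \<theta> 2"
  shows "ev x_right_slope \<rho> \<theta> = right_slope (\<theta> 2)"
proof -
  have "ev x_right_slope \<rho> \<theta> = extremum AMin (insert (chord_slope (\<theta> 2) 1)
     ((\<lambda>\<beta>. if \<theta> 2 < \<beta> then chord_slope (\<theta> 2) \<beta> else chord_slope (\<theta> 2) 1) ` candidates))"
    unfolding x_right_slope_def
    by (rule ev_candidates) (use assms candidates_bounds in \<open>auto simp: ev_chord\<close>)
  then show ?thesis by (simp add: right_slope_def extremum_def)
qed

lemma ev_candidate_value:
  assumes "0 \<le> \<theta> 2"
  shows "ev x_candidate_value \<rho> \<theta> = candidate_value (\<theta> 2)"
  using assms by (simp add: x_candidate_value_def candidate_value_def ev_right_slope)

lemma ev_optimum: "ev x_optimum \<rho> \<theta> = optimum"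
proof -
  have "ev (x_candidates AMax 2 (XLet 2 (XLit 0) x_candidate_value) x_candidate_value) \<rho> \<theta> =
      extremum AMax (insert (candidate_value 0) (candidate_value ` candidates))"
    by (rule ev_candidates) (use candidates_bounds in \<open>auto simp: ev_candidate_value\<close>)
  then have max: "ev (x_candidates AMax 2 (XLet 2 (XLit 0) x_candidate_value) x_candidate_value) \<rho> \<theta> =
      candidate_max"
    by (simp add: extremum_def candidate_max_def)
  have "ev x_optimum \<rho> \<theta> =
      extremum AMax (insert 0 ((\<lambda>\<alpha>. if candidate_value \<alpha> < candidate_max then 0 else \<alpha>) ` candidates))"
    unfolding x_optimum_def fval.simps(9) max
    by (rule ev_candidates) (use candidates_bounds in \<open>auto simp: ev_candidate_value\<close>)
  then show ?thesis by (simp add: extremum_def optimum_def)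
qed

end

section \<open>The program and its running time\<close>

definition optimum_program :: com where
  "optimum_program = Seq (compile x_optimum 1 (\<lambda>_. 0) (\<lambda>_. 0))
     (RAssign ''alpha'' (NLit 0) (NLit 0) (tmp 1))"

theorem theorem3p1:
  shows "\<exists>(prog :: com) (C :: nat) (d :: nat). \<forall>(I :: seq_contract) (ord :: strategy rel).
    valid_instance I \<longrightarrow> independent_actions I \<longrightarrow> linear_order_on (strategies I) ord \<longrightarrow>
    (\<exists>k s. exec prog (input_state I) k s \<and>
           k \<le> C * (num_actions I + num_outcomes I) ^ d \<and>
           optimal_linear I ord (machine_output s))"
proof -
  \<comment> \<open>The additional step copies the result to the output cell.\<close>
  obtain C d where Cd: "\<And>B. B \<ge> 1 \<Longrightarrow> time x_optimum B + 1 \<le> C * B ^ d"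
    using poly_bound_add[OF time_poly[of x_optimum] poly_bound_const[of 1]] by blast
  show ?thesis
  proof (rule exI[of _ optimum_program], rule exI[of _ C], rule exI[of _ d], intro allI impI)
    fix I ord
    assume I: "valid_instance I" "independent_actions I" and ord: "linear_order_on (strategies I) ord"
    interpret contract_instance I by standard (fact I)+
    let ?B = "num_actions I + num_outcomes I"
    have "\<And>b. nats (input_state I) (bound_name b) \<le> ?B" by (simp add: bound_input)
    \<comment> \<open>Starting at level 1 leaves \<open>slot 0\<close> and row 0, both zero on
      input, as the common place of all variables not yet bound.\<close>
    moreover have "matches 1 (\<lambda>_. 0) (\<lambda>_. 0) (\<lambda>_. 0) (\<lambda>_. 0) (input_state I) (input_state I)"
      by (simp add: matches_def input_state_def slot_def)
    ultimately obtain s where s: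
      "run (compile x_optimum 1 (\<lambda>_. 0) (\<lambda>_. 0)) (time x_optimum ?B) (input_state I) s"
      "reals s ''t'' 1 0 = optimum"
      using compile_correct[of "input_state I" ?B 1 "\<lambda>_. 0" "\<lambda>_. 0" "\<lambda>_. 0" "\<lambda>_. 0" "input_state I" x_optimum]
        ev_optimum by auto
    let ?s = "set_real ''alpha'' 0 0 optimum s"
    have "run (RAssign ''alpha'' (NLit 0) (NLit 0) (tmp 1)) 1 s ?s"
      using run_RAssign[of "''alpha''" "NLit 0" "NLit 0" "tmp 1" s] s(2) by simp
    from run_Seq[OF s(1) this] obtain k where k: "exec optimum_program (input_state I) k ?s"
      "k \<le> time x_optimum ?B + 1"
      unfolding optimum_program_def run_def by blast
    have "?B \<ge> 1" using I(1) by (simp add: valid_instance_def)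
    then have "k \<le> C * ?B ^ d" using Cd k(2) le_trans by blast
    then show "\<exists>k s. exec optimum_program (input_state I) k s \<and> k \<le> C * ?B ^ d \<and>
        optimal_linear I ord (machine_output s)"
      using k(1) optimal_linear_optimum[OF ord] by (force simp: machine_output_def)
  qed
qed

end
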